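(* Consider the homotopy $H:\mathbb{R}^n\times\mathbb{R}\times[0,1)\to\mathbb{R}^n\times\mathbb{R}$, $$H(\varphi,\lambda,t)=\begin{pmatrix}(1-t)A(K)\varphi+D\varphi+t\beta\varphi^3-\lambda\varphi\\ \frac12\left(\frac1h-\varphi^{\mathrm T}\varphi\right)\end{pmatrix},$$ where $A(K)=\mathrm{diag}(a_1,\dots,a_n)$ for $K=(a_1,\dots,a_n)^{\mathrm T}\in\mathbb{R}^n$. For almost all $K\in\mathbb{R}^n$: (i) $0$ is a regular value of $H$, and therefore the homotopy curves corresponding to different initial points do not intersect each other for $t\in[0,1)$; (ii) every homotopy path $(\varphi(s),\lambda(s),t(s))\subset H^{-1}(0)$ is bounded.
   Context: For a vector $\varphi$, $\varphi^3$ denotes the vector of componentwise cubes. $\Omega=[a,b]\subset\mathbb{R}$, $n\in\mathbb{N}^+$, $h=\frac{b-a}{n+1}$, $x_j=a+jh$, $V(x)=\frac12x^2$, $v_j=V(x_j)$ for $j=1,\dots,n$; $\beta\in\mathbb{R}$ is a constant. The matrix $D\in\mathbb{R}^{n\times n}$ is $D=\frac12D_1+\mathrm{diag}(v_1,\dots,v_n)$, where $D_1$ is $\frac1{h^2}$ times the tridiagonal matrix with $2$ on the diagonal and $-1$ on the sub- and superdiagonals. The initial points are $(\varphi^{(i)},\lambda_i,0)$, $i=1,\dots,n$, where $(\varphi^{(i)},\lambda_i)$ are the eigenpairs of $H(\varphi,\lambda,0)=0$ (the linear eigenvalue problem $(A(K)+D)\varphi=\lambda\varphi$, $\varphi^{\mathrm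 T}\varphi=1/h$), with $\lambda_1\le\dots\le\lambda_n$. The homotopy curve (path) corresponding to an initial point is the solution curve in $H^{-1}(0)$ starting from that point at $t=0$. *)

theory Defs
  imports "HOL-Analysis.Analysis"
begin

text \<open>
  The components of a vector in \<open>real ^ 'n\<close> are numbered \<open>1, \<dots>, n\<close>, with \<open>n = CARD('n)\<close>, by the
  position of the index in the linear order of \<open>'n\<close>.  Class \<open>wellorder\<close> is no restriction beyond
  a linear order, since \<open>'n\<close> is finite; it is the class used by the library for \<open>real ^ 'n\<close>
  whenever an order of the components is needed.
\<close>

definition pos :: "'n::{finite,wellorder} \<Rightarrow> nat" where
  "pos i = card {..i}"

definition diag :: "real ^ 'n \<Rightarrow> real ^ 'n ^ 'n" where
  "diag v = (\<chi> i j. if i = j then v $ i else 0)"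

definition cube :: "real ^ 'n \<Rightarrow> real ^ 'n" where
  "cube \<phi> = (\<chi> i. (\<phi> $ i) ^ 3)"

text \<open>Points \<open>(\<phi>, l, t)\<close>, where \<open>l\<close> stands for the eigenvalue \<open>\<lambda>\<close>.\<close>

type_synonym 'n point = "(real ^ 'n) \<times> real \<times> real"

definition mesh :: "'n itself \<Rightarrow> real \<Rightarrow> real \<Rightarrow> real" where
  "mesh _ a b = (b - a) / (real CARD('n) + 1)"

definition node :: "real \<Rightarrow> real \<Rightarrow> 'n::{finite,wellorder} \<Rightarrow> real" where
  "node a b j = a + real (pos j) * mesh TYPE('n::{finite,wellorder}) a b"

definition V :: "real \<Rightarrow> real" where
  "V x = 1/2 * x^2"

definition D1 :: "real \<Rightarrow> real \<Rightarrow> real ^ 'n::{finite,wellorder} ^ 'n::{finite,wellorder}" where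
  "D1 a b = (\<chi> i j. 1 / (mesh TYPE('n::{finite,wellorder}) a b)^2 *
     (if i = j then 2
      else if pos i = Suc (pos j) \<or> pos j = Suc (pos i) then -1
      else 0))"

definition D :: "real \<Rightarrow> real \<Rightarrow> real ^ 'n::{finite,wellorder} ^ 'n::{finite,wellorder}" where
  "D a b = (1/2) *\<^sub>R D1 a b + diag (\<chi> j. V (node a b j))"

definition H :: "real \<Rightarrow> real \<Rightarrow> real \<Rightarrow> real ^ 'n::{finite,wellorder} \<Rightarrow>
    'n::{finite,wellorder} point \<Rightarrow> (real ^ 'n::{finite,wellorder}) \<times> real" where
  "H a b \<beta> K = (\<lambda>(\<phi>, l, t).
     ((1 - t) *\<^sub>R (diag K *v \<phi>) + D a b *v \<phi> + (t * \<beta>) *\<^sub>R cube \<phi> - l *\<^sub>R \<phi>,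
      1/2 * (1 / mesh TYPE('n::{finite,wellorder}) a b - \<phi> \<bullet> \<phi>)))"

text \<open>
  \<open>H\<close> is a total function; its domain as a homotopy is the following set, and zeros and
  derivatives of \<open>H\<close> are taken relative to it (one-sided in \<open>t\<close> at \<open>t = 0\<close>).
\<close>

definition H_dom :: "'n point set" where
  "H_dom = UNIV \<times> UNIV \<times> {0..<1}"

definition H_zeros :: "real \<Rightarrow> real \<Rightarrow> real \<Rightarrow> real ^ 'n::{finite,wellorder} \<Rightarrow>
    'n::{finite,wellorder} point set" where
  "H_zeros a b \<beta> K = {p \<in> H_dom. H a b \<beta> K p = 0}"

text \<open>
  Derivatives within \<open>H_dom\<close> are unique (also at \<open>t = 0\<close>), so the existential quantifier just names
  the Jacobian.
\<close>

definition regular_value ::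
    "('a::real_normed_vector \<Rightarrow> 'b::real_normed_vector) \<Rightarrow> 'a set \<Rightarrow> 'b \<Rightarrow> bool" where
  "regular_value f S y \<longleftrightarrow>
     (\<forall>x\<in>S. f x = y \<longrightarrow> (\<exists>f'. (f has_derivative f') (at x within S) \<and> surj f'))"

text \<open>
  An eigenpair is normalised only up to the sign of the eigenvector; both signs are admitted here,
  so that statements about distinct initial points cover every choice and every numbering of \<open>n\<close>
  eigenpairs.
\<close>

definition initial_points :: "real \<Rightarrow> real \<Rightarrow> real \<Rightarrow> real ^ 'n::{finite,wellorder} \<Rightarrow>
    'n::{finite,wellorder} point set" where
  "initial_points a b \<beta> K = {(\<phi>, l, t). t = 0 \<and> H a b \<beta> K (\<phi>, l, 0) = 0}"

text \<open>
  A homotopy path from \<open>p\<close>, given by \<open>\<gamma> s = (\<phi> s, l s, t s)\<close> for \<open>s\<close> in a parameter interval \<open>S\<close>.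
  \<open>S\<close> may be half-open or unbounded, so the whole solution curve through \<open>p\<close> is included and not
  only its compact arcs.  No differentiability, injectivity or monotonicity of \<open>t s\<close> is required.
\<close>

definition homotopy_path :: "real \<Rightarrow> real \<Rightarrow> real \<Rightarrow> real ^ 'n::{finite,wellorder} \<Rightarrow>
    'n::{finite,wellorder} point \<Rightarrow>
    real set \<Rightarrow> (real \<Rightarrow> 'n::{finite,wellorder} point) \<Rightarrow> bool" where
  "homotopy_path a b \<beta> K p S \<gamma> \<longleftrightarrow>
     is_interval S \<and> 0 \<in> S \<and> S \<subseteq> {0..} \<and>
     continuous_on S \<gamma> \<and> \<gamma> ` S \<subseteq> H_zeros a b \<beta> K \<and> \<gamma> 0 = p"

end

theory Submission
  imports Defs "HOL-Computational_Algebra.Polynomial"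
begin

text \<open>
  If \<open>(\<phi>, l, t)\<close> is a zero of \<open>H\<close>, then \<open>\<phi>\<close> is an eigenvector of a Jacobi matrix, so the neighbours of
  a vanishing component have opposite signs.  Hence the number of sign changes of \<open>\<phi>\<close> and the sign
  of \<open>\<phi>\<^sub>1\<close> are constant along connected sets of zeros.  At \<open>t = 0\<close> they determine the zero, by Sturm
  oscillation, so paths from distinct initial points are disjoint.

  The derivative of \<open>H\<close> with respect to \<open>K\<close> degenerates where a component of \<open>\<phi>\<close> vanishes.  For the
  regular value, the zeros for all \<open>K\<close> together are therefore parametrised by \<open>n + 1\<close> numbers, from
  which \<open>K\<close> is recovered by a rational map.  At a non-regular zero this map is not a submersion, and
  moreover a nontrivial polynomial in the parameters vanishes.  On the hypersurfaces where it does,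
  the equal-dimensional case of Sard's theorem shows that the exceptional \<open>K\<close> form a null set.
\<close>

text \<open>Regularity alone does not separate the paths: it makes the zero set a curve near each
  zero, but an arc could leave \<open>t = 0\<close> at one initial point and return to it at
  another. Excluding this takes an invariant of whole components, which the sign pattern provides.

  Parametric transversality is obstructed because the \<open>K\<close>-derivative of
  \<open>H\<close> is \<open>(1 - t) diag \<phi>\<close>, and eigenvectors may have vanishing
  entries. Solving for \<open>K\<close> instead gives a map from dimension n + 1 to n, for which
  Sard's theorem asks for more than C1. An additional equation satisfied at every critical zero
  brings the dimension down to n. It comes from the kernel of the transposed Jacobian, which is a
  system in two unknowns once the recurrence is solved from the left end. Its determinant is
  nontrivial because at \<open>\<tau> = 0\<close> the problem is linear, and the eigenvalues of a
  Jacobi matrix are simple.\<close>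

section \<open>Sign changes of three-term recurrences\<close>

text \<open>The sign of \<open>u k\<close>; a zero takes the sign of its right neighbour.\<close>

definition eff_pos :: "(nat \<Rightarrow> real) \<Rightarrow> nat \<Rightarrow> bool" where
  "eff_pos u k \<longleftrightarrow> u k > 0 \<or> (u k = 0 \<and> u (Suc k) > 0)"

primrec sign_changes :: "(nat \<Rightarrow> real) \<Rightarrow> nat \<Rightarrow> nat" where
  "sign_changes u 0 = 0"
| "sign_changes u (Suc k) = sign_changes u k + (if eff_pos u k \<noteq> eff_pos u (Suc k) then 1 else 0)"

text \<open>Kernel vectors of the Jacobi matrix with diagonal \<open>g\<close> and off-diagonal
  entries \<open>- c\<close>, under Dirichlet conditions at 0 and n + 1;
  \<open>u 1 \<noteq> 0\<close> excludes the zero solution.\<close>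

definition jacobi_solution :: "real \<Rightarrow> (nat \<Rightarrow> real) \<Rightarrow> nat \<Rightarrow> (nat \<Rightarrow> real) \<Rightarrow> bool" where
  "jacobi_solution c g n u \<longleftrightarrow>
     u 0 = 0 \<and> u (Suc n) = 0 \<and> u 1 \<noteq> 0 \<and>
     (\<forall>k\<in>{1..n}. g k * u k = c * (u (k - 1) + u (Suc k)))"

text \<open>The part of \<open>jacobi_solution\<close> that does not mention the diagonal. The
  continuity argument rests on it, since the diagonal varies along a path.\<close>

definition isolated_zeros :: "nat \<Rightarrow> (nat \<Rightarrow> real) \<Rightarrow> bool" where
  "isolated_zeros n u \<longleftrightarrow>
     u 0 = 0 \<and> u 1 \<noteq> 0 \<and> (\<forall>k\<in>{1..n}. u k = 0 \<longrightarrow> u (k - 1) * u (Suc k) < 0)"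

text \<open>At a zero the recurrence reads \<open>u (k - 1) + u (Suc k) = 0\<close>, and two
  adjacent zeros would propagate back to \<open>u 1 = 0\<close>.\<close>

lemma jacobi_solution_isolated_zeros:
  assumes "c > 0" and j: "jacobi_solution c g n u"
  shows "isolated_zeros n u"
proof -
  have rec: "g k * u k = c * (u (k - 1) + u (Suc k))" if "k \<in> {1..n}" for k
    using j that by (simp add: jacobi_solution_def)
  have nz: "k \<le> n \<Longrightarrow> u k \<noteq> 0 \<or> u (Suc k) \<noteq> 0" for k
  proof (induction k)
    case 0
    then show ?case using j by (simp add: jacobi_solution_def)
  next
    case (Suc k)
    then show ?case using rec[of "Suc k"] \<open>c > 0\<close> by auto
  qed
  have "u (k - 1) * u (Suc k) < 0" if k: "k \<in> {1..n}" and z: "u k = 0" for k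
  proof -
    have eq: "u (Suc k) = - u (k - 1)"
      using rec[OF k] z \<open>c > 0\<close> by auto
    have "u (Suc k) \<noteq> 0" using nz[of k] k z by auto
    then show ?thesis unfolding eq
      by (auto simp: mult_less_0_iff zero_less_mult_iff linorder_neq_iff)
  qed
  then show ?thesis using j by (simp add: isolated_zeros_def jacobi_solution_def)
qed

lemma jacobi_solution_last_nonzero:
  assumes "c > 0" "n \<ge> 1" and j: "jacobi_solution c g n u"
  shows "u n \<noteq> 0"
  using jacobi_solution_isolated_zeros[OF assms(1) j] j assms(2)
  by (auto simp: isolated_zeros_def jacobi_solution_def dest!: bspec[where x = n])

lemma eff_pos_cases:
  assumes "isolated_zeros n u" "k \<in> {1..n}"
  shows "eff_pos u k \<and> u k \<ge> 0 \<and> (u k = 0 \<longrightarrow> u (Suc k) > 0 \<and> u (k - 1) < 0) \<or>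
         \<not> eff_pos u k \<and> u k \<le> 0 \<and> (u k = 0 \<longrightarrow> u (Suc k) < 0 \<and> u (k - 1) > 0)"
  using assms by (auto simp: isolated_zeros_def eff_pos_def mult_less_0_iff)

text \<open>As long as the solution for the larger eigenvalue \<open>m\<close> has no more sign changes than the one
  for \<open>l\<close>, the discrete Wronskian stays negative; but it vanishes at \<open>n\<close>.\<close>

lemma sign_changes_less:
  assumes c: "c > 0" and n: "n \<ge> 1" and lm: "l < m"
    and u: "jacobi_solution c (\<lambda>k. g k - l) n u"
    and w: "jacobi_solution c (\<lambda>k. g k - m) n w"
    and s1: "u 1 * w 1 > 0"
  shows "sign_changes u n < sign_changes w n"
proof -
  define W where "W k = u k * w (Suc k) - u (Suc k) * w k" for k
  have iu: "isolated_zeros n u" and iw: "isolated_zeros n w"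
    using jacobi_solution_isolated_zeros c u w by blast+
  \<comment> \<open>Eliminating \<open>g\<close> from the two recurrences leaves only the gap
    \<open>l - m < 0\<close>, so \<open>W\<close> decreases where \<open>u\<close> and
    \<open>w\<close> agree in sign.\<close>
  have Wrec: "c * (W (Suc k) - W k) = (l - m) * (u (Suc k) * w (Suc k))" if "Suc k \<le> n" for k
  proof -
    have "(g (Suc k) - l) * u (Suc k) = c * (u k + u (Suc (Suc k)))"
      using u that by (auto simp: jacobi_solution_def dest!: bspec[where x = "Suc k"])
    moreover have "(g (Suc k) - m) * w (Suc k) = c * (w k + w (Suc (Suc k)))"
      using w that by (auto simp: jacobi_solution_def dest!: bspec[where x = "Suc k"])
    ultimately show ?thesis unfolding W_def by algebra
  qed
  have Wdec: "W (Suc k) \<le> W k" "u (Suc k) * w (Suc k) \<noteq> 0 \<Longrightarrow> W (Suc k) < W k"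
    if "Suc k \<le> n" "u (Suc k) * w (Suc k) \<ge> 0" for k
  proof -
    have "(l - m) * (u (Suc k) * w (Suc k)) \<le> 0"
      using that lm by (simp add: mult_nonpos_nonneg)
    then have "c * (W (Suc k) - W k) \<le> 0" using Wrec[OF that(1)] by simp
    then show "W (Suc k) \<le> W k" using c by (simp add: mult_le_0_iff)
    assume "u (Suc k) * w (Suc k) \<noteq> 0"
    then have "(l - m) * (u (Suc k) * w (Suc k)) < 0"
      using that lm by (intro mult_neg_pos) (auto simp: order_le_less)
    then have "c * (W (Suc k) - W k) < 0" using Wrec[OF that(1)] by simp
    then show "W (Suc k) < W k" using c by (simp add: mult_less_0_iff)
  qed
  define par where "par k \<longleftrightarrow> (eff_pos u k \<longleftrightarrow> eff_pos w k)" for k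
  \<comment> \<open>Either \<open>w\<close> is strictly ahead, or there is a tie and
    \<open>W\<close> is negative. The parity clause turns a tie into agreement of the effective
    signs.\<close>
  have inv: "(sign_changes u (Suc k) < sign_changes w (Suc k) \<or>
              sign_changes u (Suc k) = sign_changes w (Suc k) \<and> W (Suc k) < 0) \<and>
             (par (Suc k) \<longleftrightarrow> even (sign_changes u (Suc k) + sign_changes w (Suc k)))"
    if "Suc k \<le> n" for k
    using that
  proof (induction k)
    case 0
    have u0: "u 0 = 0" "w 0 = 0" "u (Suc 0) \<noteq> 0" "w (Suc 0) \<noteq> 0"
      using u w by (simp_all add: jacobi_solution_def)
    then have "W 0 = 0" by (simp add: W_def)
    then have "W (Suc 0) < 0" using Wdec(2)[of 0] s1 n u0 by auto
    moreover have "eff_pos u 0 = eff_pos u 1" "eff_pos w 0 = eff_pos w 1" "par 1"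
      using u0 s1 by (auto simp: eff_pos_def par_def zero_less_mult_iff)
    ultimately show ?case by simp
  next
    case (Suc k)
    define i where "i = Suc k"
    have i: "i \<in> {1..n}" "Suc i \<in> {1..n}" using Suc.prems by (auto simp: i_def)
    note E = eff_pos_cases[OF iu i(1)] eff_pos_cases[OF iw i(1)]
             eff_pos_cases[OF iu i(2)] eff_pos_cases[OF iw i(2)]
    have IH: "(sign_changes u i < sign_changes w i \<or>
              sign_changes u i = sign_changes w i \<and> W i < 0)"
      "par i \<longleftrightarrow> even (sign_changes u i + sign_changes w i)"
      using Suc by (auto simp: i_def)
    have parity: "par (Suc i) \<longleftrightarrow> even (sign_changes u (Suc i) + sign_changes w (Suc i))"
      using IH(2) by (auto simp: par_def)
    have par': "u (Suc i) * w (Suc i) \<ge> 0" if "par (Suc i)"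
      using that E by (auto simp: par_def mult_nonneg_nonneg mult_nonpos_nonpos)
    have "sign_changes u (Suc i) < sign_changes w (Suc i) \<or>
          sign_changes u (Suc i) = sign_changes w (Suc i) \<and> W (Suc i) < 0"
    proof (cases "sign_changes u i = sign_changes w i")
      case True
      then have Wi: "W i < 0" and pi: "par i" using IH by auto
      \<comment> \<open>In a tie \<open>u\<close> cannot gain a change alone: the signs would force
        \<open>W i \<ge> 0\<close>.\<close>
      have no: "\<not> (eff_pos u i \<noteq> eff_pos u (Suc i) \<and> eff_pos w i = eff_pos w (Suc i))"
      proof
        assume a: "eff_pos u i \<noteq> eff_pos u (Suc i) \<and> eff_pos w i = eff_pos w (Suc i)"
        have "u i * w (Suc i) \<ge> 0" "u (Suc i) * w i \<le> 0"
          using a pi E by (auto simp: par_def zero_le_mult_iff mult_le_0_iff)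
        then show False using Wi by (simp add: W_def)
      qed
      show ?thesis
      proof (cases "par (Suc i)")
        case True2: True
        then have "W (Suc i) < 0" using Wdec(1)[of i] par' i Wi by auto
        moreover have "sign_changes u (Suc i) = sign_changes w (Suc i)"
          using True True2 pi by (auto simp: par_def)
        ultimately show ?thesis by blast
      next
        case False
        then show ?thesis using True no pi by (auto simp: par_def)
      qed
    next
      case False
      then have lt: "sign_changes u i < sign_changes w i" using IH by auto
      show ?thesis
      proof (cases "sign_changes u (Suc i) < sign_changes w (Suc i)")
        \<comment> \<open>A lead of \<open>w\<close> is lost only if \<open>u\<close> changes sign
          alone. The signs then give \<open>W i \<le> 0\<close>, and either this or the decrease to
          \<open>W (Suc i)\<close> is strict.\<close>
        case False2: False
        then have ch: "eff_pos u i \<noteq> eff_pos u (Suc i)" "eff_pos w i = eff_pos w (Suc i)"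
          and eq: "sign_changes u (Suc i) = sign_changes w (Suc i)"
          using lt by (auto split: if_splits)
        then have p1: "par (Suc i)" using parity by simp
        have "W i \<le> 0"
        proof -
          have "u i * w (Suc i) \<le> 0" "u (Suc i) * w i \<ge> 0"
            using ch p1 E by (auto simp: par_def zero_le_mult_iff mult_le_0_iff)
          then show ?thesis by (simp add: W_def)
        qed
        moreover have "W i < 0 \<or> u (Suc i) * w (Suc i) \<noteq> 0"
        proof (rule ccontr)
          assume "\<not> ?thesis"
          then have z: "u (Suc i) = 0 \<or> w (Suc i) = 0" "W i \<ge> 0" by auto
          have wz: "w (Suc i) \<noteq> 0" using ch p1 E by (auto simp: par_def)
          with z have uz: "u (Suc i) = 0" by simp
          then have "u i \<noteq> 0" using E by auto
          with uz wz have "u i * w (Suc i) < 0"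
            using ch p1 E by (auto simp: par_def mult_less_0_iff)
          then show False using z uz by (simp add: W_def)
        qed
        ultimately have "W (Suc i) < 0"
          using Wdec[of i] par'[OF p1] i by fastforce
        then show ?thesis using eq by blast
      qed auto
    qed
    then show ?case using parity by (simp add: i_def)
  qed
  obtain k where k: "n = Suc k" using n by (cases n) auto
  \<comment> \<open>Both solutions vanish at \<open>Suc n\<close>, which rules out the tie at
    \<open>n\<close>.\<close>
  have "W n = 0" using u w by (simp add: W_def jacobi_solution_def)
  then show ?thesis using inv[of k] k by auto
qed

text \<open>A solution starting from 0 is determined by its value at 1. The cross-multiplied form
  avoids dividing by \<open>u 1\<close> or \<open>w 1\<close>, either of which may be 0.\<close>

lemma three_term_proportional:
  fixes u w :: "nat \<Rightarrow> real"
  assumes c: "c \<noteq> 0" and "u 0 = 0" "w 0 = 0"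
    and u: "\<And>k. k \<in> {1..n} \<Longrightarrow> g k * u k = c * (u (k - 1) + u (Suc k))"
    and w: "\<And>k. k \<in> {1..n} \<Longrightarrow> g k * w k = c * (w (k - 1) + w (Suc k))"
    and "k \<le> Suc n"
  shows "u 1 * w k = w 1 * u k"
  using \<open>k \<le> Suc n\<close>
proof (induction k rule: less_induct)
  case (less k)
  consider "k = 0" | "k = 1" | j where "k = Suc (Suc j)"
    by (metis One_nat_def not0_implies_Suc)
  then show ?case
  proof cases
    case 1 then show ?thesis using assms by simp
  next
    case 3
    then have j: "Suc j \<in> {1..n}" using less.prems by auto
    have "g (Suc j) * u (Suc j) = c * (u j + u k)" "g (Suc j) * w (Suc j) = c * (w j + w k)"
      using u[OF j] w[OF j] 3 by auto
    moreover have "u 1 * w j = w 1 * u j" "u 1 * w (Suc j) = w 1 * u (Suc j)"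
      using less.IH[of j] less.IH[of "Suc j"] 3 less.prems by auto
    ultimately have "c * (u 1 * w k) = c * (w 1 * u k)" by algebra
    then show ?thesis using c by simp
  qed auto
qed

lemma jacobi_solution_unique:
  assumes "c > 0" "jacobi_solution c g n u" "jacobi_solution c g n w" "k \<le> Suc n"
  shows "u 1 * w k = w 1 * u k"
  using assms by (intro three_term_proportional[where c = c and g = g and n = n])
    (auto simp: jacobi_solution_def)

lemma jacobi_solution_eq_if_same_sign_changes:
  assumes c: "c > 0" and n: "n \<ge> 1"
    and u: "jacobi_solution c (\<lambda>k. g k - l) n u"
    and w: "jacobi_solution c (\<lambda>k. g k - m) n w"
    and s1: "u 1 * w 1 > 0" and sc: "sign_changes u n = sign_changes w n"
  shows "l = m"
proof (rule linorder_cases[of l m])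
  assume "l < m" then show ?thesis using sign_changes_less[OF c n _ u w s1] sc by simp
next
  assume "m < l" then show ?thesis using sign_changes_less[OF c n _ w u] s1 sc
    by (simp add: mult.commute)
qed

section \<open>Stability of the sign-change count under limits\<close>

lemma eventually_eff_pos:
  assumes "\<And>k. ((\<lambda>x. X x k) \<longlongrightarrow> u k) F" "u k \<noteq> 0"
  shows "\<forall>\<^sub>F x in F. X x k \<noteq> 0 \<and> (X x k > 0 \<longleftrightarrow> u k > 0) \<and> eff_pos (X x) k = eff_pos u k"
proof (cases "u k > 0")
  case True
  from order_tendstoD(1)[OF assms(1) this] show ?thesis
    by eventually_elim (use True in \<open>auto simp: eff_pos_def\<close>)
next
  case False
  then have "u k < 0" using assms(2) by simp
  from order_tendstoD(2)[OF assms(1) this] show ?thesis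
    by eventually_elim (use \<open>u k < 0\<close> in \<open>auto simp: eff_pos_def\<close>)
qed

text \<open>A zero of \<open>u\<close> may be perturbed to either sign, but its neighbours keep
  their opposite signs, so exactly one change is counted across it in every case. The induction
  therefore visits only indices with \<open>u k \<noteq> 0\<close> and jumps over zeros.\<close>

lemma eventually_sign_changes_eq:
  assumes lim: "\<And>k. ((\<lambda>x. X x k) \<longlongrightarrow> u k) F"
    and ev: "\<forall>\<^sub>F x in F. isolated_zeros n (X x)" and u: "isolated_zeros n u"
    and "k \<le> n" "k \<ge> 1" "u k \<noteq> 0"
  shows "\<forall>\<^sub>F x in F. sign_changes (X x) k = sign_changes u k"
  using assms(4-6)
proof (induction k rule: less_induct)
  case (less k)
  obtain j where kj: "k = Suc j" using less.prems by (cases k) auto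
  have u1: "u 1 \<noteq> 0" and u0: "u 0 = 0" using u by (auto simp: isolated_zeros_def)
  show ?case
  proof (cases "j = 0")
    case True
    show ?thesis using ev eventually_eff_pos[where X = X and u = u, OF lim u1]
      by eventually_elim (use True kj u0 u1 in \<open>auto simp: isolated_zeros_def eff_pos_def\<close>)
  next
    case j: False
    show ?thesis
    proof (cases "u j = 0")
      case False
      from less.IH[of j] have "\<forall>\<^sub>F x in F. sign_changes (X x) j = sign_changes u j"
        using False j kj less.prems by auto
      then show ?thesis using eventually_eff_pos[where X = X and u = u, OF lim False] eventually_eff_pos[where X = X and u = u, OF lim less.prems(3)]
        by eventually_elim (simp add: kj)
    next
      case z: True
      then obtain i where i: "j = Suc i" "i \<noteq> 0" using j u1 by (cases j) auto
      have opp: "u i * u (Suc (Suc i)) < 0"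
        using u z i kj less.prems by (auto simp: isolated_zeros_def dest!: bspec[where x = j])
      then have nz: "u i \<noteq> 0" "u (Suc (Suc i)) \<noteq> 0" by auto
      from less.IH[of i] have "\<forall>\<^sub>F x in F. sign_changes (X x) i = sign_changes u i"
        using i kj less.prems nz by auto
      then show ?thesis using eventually_eff_pos[where X = X and u = u, OF lim nz(1)] eventually_eff_pos[where X = X and u = u, OF lim nz(2)]
      proof eventually_elim
        case (elim x)
        then have "eff_pos (X x) i \<noteq> eff_pos (X x) (Suc (Suc i))"
          using opp by (auto simp: eff_pos_def mult_less_0_iff)
        moreover have "eff_pos u i \<noteq> eff_pos u (Suc (Suc i))"
          using opp by (auto simp: eff_pos_def mult_less_0_iff)
        ultimately show ?case using elim by (auto simp: i kj)
      qed
    qed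
  qed
qed

section \<open>A Sard theorem on zero sets of polynomial families\<close>

text \<open>Polynomials in one variable whose coefficients are polynomial functions of a vector.\<close>

inductive polyfam :: "('a::euclidean_space \<Rightarrow> real poly) \<Rightarrow> bool" where
  const: "polyfam (\<lambda>_. p)"
| coord: "polyfam (\<lambda>z. [:z \<bullet> b:])"
| add: "polyfam F \<Longrightarrow> polyfam G \<Longrightarrow> polyfam (\<lambda>z. F z + G z)"
| mult: "polyfam F \<Longrightarrow> polyfam G \<Longrightarrow> polyfam (\<lambda>z. F z * G z)"

section \<open>Closure and smoothness of polynomial families\<close>

lemma polyfam_diff: "polyfam F \<Longrightarrow> polyfam G \<Longrightarrow> polyfam (\<lambda>z. F z - G z)"
  using polyfam.add[OF _ polyfam.mult[OF polyfam.const[of "-1"]], of F G] by simp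

lemma polyfam_sum: "(\<And>i. i \<in> I \<Longrightarrow> polyfam (F i)) \<Longrightarrow> polyfam (\<lambda>z. \<Sum>i\<in>I. F i z)"
  by (induction I rule: infinite_finite_induct) (auto intro: polyfam.intros)

lemma polyfam_power: "polyfam F \<Longrightarrow> polyfam (\<lambda>z. F z ^ k)"
  by (induction k) (auto intro: polyfam.intros)

lemma polyfam_pderiv: "polyfam F \<Longrightarrow> polyfam (\<lambda>z. pderiv (F z))"
proof (induction rule: polyfam.induct)
  case (mult F G)
  then show ?case by (auto simp: pderiv_mult intro!: polyfam.intros)
qed (auto simp: pderiv_add pderiv_pCons intro!: polyfam.intros)

lemma polyfam_funpow_pderiv: "polyfam F \<Longrightarrow> polyfam (\<lambda>z. (pderiv ^^ k) (F z))"
  by (induction k) (auto intro: polyfam_pderiv)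

text \<open>Makes the algebraic \<open>pderiv\<close> available as the partial derivative in the
  last variable, which the inverse function theorem requires to be nonzero.\<close>

lemma polyfam_C1:
  assumes "polyfam F"
  obtains F' :: "('a::euclidean_space \<times> real) \<Rightarrow> ('a \<times> real) \<Rightarrow>\<^sub>L real"
  where "\<And>x. ((\<lambda>x. poly (F (fst x)) (snd x)) has_derivative blinfun_apply (F' x)) (at x)"
    and "continuous_on UNIV F'"
    and "\<And>x. F' x (0, 1) = poly (pderiv (F (fst x))) (snd x)"
proof -
  have "\<exists>F' :: ('a \<times> real) \<Rightarrow> ('a \<times> real) \<Rightarrow>\<^sub>L real.
    (\<forall>x. ((\<lambda>x. poly (F (fst x)) (snd x)) has_derivative blinfun_apply (F' x)) (at x)) \<and>
    continuous_on UNIV F' \<and>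
    (\<forall>x. F' x (0, 1) = poly (pderiv (F (fst x))) (snd x))"
    using assms
  proof (induction rule: polyfam.induct)
    case (const p)
    define F' :: "('a \<times> real) \<Rightarrow> ('a \<times> real) \<Rightarrow>\<^sub>L real"
      where "F' x = poly (pderiv p) (snd x) *\<^sub>R Blinfun snd" for x
    have bl: "blinfun_apply (Blinfun (snd :: 'a \<times> real \<Rightarrow> real)) = snd"
      by (intro bounded_linear_Blinfun_apply bounded_linear_snd)
    have "((\<lambda>x. poly p (snd x)) has_derivative (\<lambda>v. poly (pderiv p) (snd x) * snd v)) (at x)"
      for x :: "'a \<times> real"
      using has_derivative_compose[OF has_derivative_snd[OF has_derivative_ident],
        of "poly p" "\<lambda>v. poly (pderiv p) (snd x) * v" x UNIV] poly_DERIV[of p "snd x"]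
      by (simp add: has_field_derivative_def)
    moreover have "continuous_on UNIV F'" unfolding F'_def by (intro continuous_intros)
    ultimately show ?case
      by (intro exI[of _ F']) (simp add: F'_def scaleR_blinfun.rep_eq bl)
  next
    case (coord b)
    have bl: "bounded_linear (\<lambda>v::'a \<times> real. fst v \<bullet> b)"
      by (intro bounded_linear_inner_left_comp bounded_linear_fst)
    then have "((\<lambda>v::'a \<times> real. fst v \<bullet> b) has_derivative (\<lambda>v. fst v \<bullet> b)) (at x)" for x
      by (rule bounded_linear_imp_has_derivative)
    then show ?case
      by (intro exI[of _ "\<lambda>_. Blinfun (\<lambda>v. fst v \<bullet> b)"])
        (simp add: bounded_linear_Blinfun_apply[OF bl])
  next
    case (add F G)
    then obtain F' G' where IH:
      "\<And>x. ((\<lambda>x. poly (F (fst x)) (snd x)) has_derivative blinfun_apply (F' x)) (at x)"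
      "continuous_on UNIV F'" "\<And>x. F' x (0, 1) = poly (pderiv (F (fst x))) (snd x)"
      "\<And>x. ((\<lambda>x. poly (G (fst x)) (snd x)) has_derivative blinfun_apply (G' x)) (at x)"
      "continuous_on UNIV G'" "\<And>x. G' x (0, 1) = poly (pderiv (G (fst x))) (snd x)"
      by blast
    show ?case
      by (intro exI[of _ "\<lambda>x. F' x + G' x"])
        (auto simp: pderiv_add IH plus_blinfun.rep_eq intro!: continuous_intros has_derivative_add IH)
  next
    case (mult F G)
    then obtain F' G' where IH:
      "\<And>x. ((\<lambda>x. poly (F (fst x)) (snd x)) has_derivative blinfun_apply (F' x)) (at x)"
      "continuous_on UNIV F'" "\<And>x. F' x (0, 1) = poly (pderiv (F (fst x))) (snd x)"
      "\<And>x. ((\<lambda>x. poly (G (fst x)) (snd x)) has_derivative blinfun_apply (G' x)) (at x)"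
      "continuous_on UNIV G'" "\<And>x. G' x (0, 1) = poly (pderiv (G (fst x))) (snd x)"
      by blast
    have "continuous (at x) (\<lambda>x. poly (F (fst x)) (snd x))"
      "continuous (at x) (\<lambda>x. poly (G (fst x)) (snd x))" for x
      using IH(1)[of x] IH(4)[of x] by (auto intro: has_derivative_continuous)
    then have c: "continuous_on UNIV (\<lambda>x. poly (F (fst x)) (snd x))"
      "continuous_on UNIV (\<lambda>x. poly (G (fst x)) (snd x))"
      by (simp_all add: continuous_at_imp_continuous_on)
    have d: "((\<lambda>x. poly (F (fst x) * G (fst x)) (snd x)) has_derivative
        blinfun_apply (poly (F (fst x)) (snd x) *\<^sub>R G' x + poly (G (fst x)) (snd x) *\<^sub>R F' x)) (at x)" for x
      using has_derivative_mult[OF IH(1)[of x] IH(4)[of x]]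
      by (simp add: plus_blinfun.rep_eq scaleR_blinfun.rep_eq mult.commute)
    show ?case
    proof (intro exI[of _ "\<lambda>x. poly (F (fst x)) (snd x) *\<^sub>R G' x + poly (G (fst x)) (snd x) *\<^sub>R F' x"]
        conjI allI d)
      show "continuous_on UNIV
          (\<lambda>x. poly (F (fst x)) (snd x) *\<^sub>R G' x + poly (G (fst x)) (snd x) *\<^sub>R F' x)"
        by (intro continuous_intros IH c)
    qed (simp add: pderiv_mult IH(3,6) plus_blinfun.rep_eq scaleR_blinfun.rep_eq)
  qed
  then show ?thesis using that by blast
qed

lemma polyfam_differentiable:
  assumes "polyfam F" shows "(\<lambda>x. poly (F (fst x)) (snd x)) differentiable at x"
  using polyfam_C1[OF assms] unfolding differentiable_def by metis

text \<open>Implicit function theorem in straightened form: \<open>(fst x, g x)\<close> is a local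
  coordinate system, in which the level set \<open>g = 0\<close> is the graph
  \<open>z \<mapsto> h (z, 0)\<close>.\<close>

lemma local_solve_last:
  fixes g :: "'a::euclidean_space \<times> real \<Rightarrow> real" and g' :: "'a \<times> real \<Rightarrow> ('a \<times> real) \<Rightarrow>\<^sub>L real"
  assumes der: "\<And>x. (g has_derivative blinfun_apply (g' x)) (at x)"
    and cont: "continuous_on UNIV g'" and nz: "g' x0 (0, 1) \<noteq> 0"
  obtains N V h where "open N" "x0 \<in> N" "open V"
    "\<And>x. x \<in> N \<Longrightarrow> (fst x, g x) \<in> V \<and> h (fst x, g x) = x"
    "\<And>y. y \<in> V \<Longrightarrow> h differentiable (at y)"
proof -
  define P :: "('a \<times> real) \<Rightarrow>\<^sub>L ('a \<times> real)" where "P = Blinfun (\<lambda>v. (fst v, 0))"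
  define Q :: "real \<Rightarrow>\<^sub>L ('a \<times> real)" where "Q = Blinfun (\<lambda>r. (0, r))"
  have P: "blinfun_apply P = (\<lambda>v. (fst v, 0))" unfolding P_def
    by (intro bounded_linear_Blinfun_apply bounded_linear_Pair bounded_linear_fst bounded_linear_zero)
  have Q: "blinfun_apply Q = (\<lambda>r. (0, r))" unfolding Q_def
    by (intro bounded_linear_Blinfun_apply bounded_linear_Pair bounded_linear_ident bounded_linear_zero)
  define f where "f x = (fst x, g x)" for x
  define f' where "f' x = P + (Q o\<^sub>L g' x)" for x
  have f': "blinfun_apply (f' x) v = (fst v, g' x v)" for x v
    by (simp add: f'_def plus_blinfun.rep_eq P Q)
  have derf: "(f has_derivative blinfun_apply (f' x)) (at x)" for x
    unfolding f_def f'[abs_def]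
    by (intro has_derivative_Pair has_derivative_fst has_derivative_ident der)
  have contf: "continuous_on UNIV f'"
    unfolding f'_def by (intro continuous_intros cont)
  define d where "d = g' x0 (0, 1)"
  \<comment> \<open>Solving \<open>(v, g' (v, r)) = (v, q)\<close> for the last coordinate gives
    \<open>r = (q - g' (v, 0)) / d\<close>.\<close>
  define inv where "inv = P + (1 / d) *\<^sub>R (Q o\<^sub>L (Blinfun snd - (g' x0 o\<^sub>L P)))"
  have bs: "blinfun_apply (Blinfun (snd :: 'a \<times> real \<Rightarrow> real)) = snd"
    by (intro bounded_linear_Blinfun_apply bounded_linear_snd)
  have split: "g' x0 v = g' x0 (fst v, 0) + snd v * d" for v
  proof -
    have "v = (fst v, 0) + snd v *\<^sub>R (0, 1)" by (cases v) simp
    then have "g' x0 v = g' x0 (fst v, 0) + snd v *\<^sub>R g' x0 (0, 1)"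
      by (metis blinfun.add_right blinfun.scaleR_right)
    then show ?thesis by (simp add: d_def)
  qed
  have "inv o\<^sub>L f' x0 = id_blinfun"
  proof (rule blinfun_eqI)
    fix v
    show "blinfun_apply (inv o\<^sub>L f' x0) v = blinfun_apply id_blinfun v"
      using split[of v] nz
      by (simp add: inv_def f' plus_blinfun.rep_eq minus_blinfun.rep_eq scaleR_blinfun.rep_eq
          P Q bs d_def prod_eq_iff)
  qed
  from inverse_function_theorem[OF open_UNIV derf contf UNIV_I this]
  obtain U' V h h' where *: "open U'" "x0 \<in> U'" "open V" "homeomorphism U' V f h"
    "\<And>y. y \<in> V \<Longrightarrow> (h has_derivative (h' y)) (at y)" by metis
  show ?thesis
  proof (rule that[of U' V h])
    show "(fst x, g x) \<in> V \<and> h (fst x, g x) = x" if "x \<in> U'" for x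
      using *(4) that unfolding homeomorphism_def f_def by blast
    show "h differentiable (at y)" if "y \<in> V" for y
      using *(5)[OF that] by (auto simp: differentiable_def)
  qed (use * in auto)
qed

text \<open>In the chart \<open>z \<mapsto> h (z, 0)\<close> the level set has the dimension of the
  target. The derivative of \<open>f\<close> along the chart factors through a non-surjective map,
  so its rank drops and \<open>baby_Sard\<close> applies.\<close>

lemma negligible_image_regular_level_set:
  fixes f :: "(real ^ 'n::{finite,wellorder}) \<times> real \<Rightarrow> real ^ 'n::{finite,wellorder}"
    and g' :: "(real ^ 'n::{finite,wellorder}) \<times> real \<Rightarrow> ((real ^ 'n::{finite,wellorder}) \<times> real) \<Rightarrow>\<^sub>L real"
  assumes der: "\<And>x. (g has_derivative blinfun_apply (g' x)) (at x)"
    and cont: "continuous_on UNIV g'"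
    and B: "\<And>x. x \<in> B \<Longrightarrow> g x = 0 \<and> g' x (0, 1) \<noteq> 0 \<and>
      (\<exists>f'. (f has_derivative f') (at x) \<and> \<not> surj f')"
  shows "negligible (f ` B)"
proof -
  have loc: "\<exists>N. open N \<and> x0 \<in> N \<and> negligible (f ` (B \<inter> N))" if "x0 \<in> B" for x0
  proof -
    have "g' x0 (0, 1) \<noteq> 0" using B[OF that] by blast
    then obtain N V h where N: "open N" "x0 \<in> N" "open V"
      "\<And>x. x \<in> N \<Longrightarrow> (fst x, g x) \<in> V \<and> h (fst x, g x) = x"
      "\<And>y. y \<in> V \<Longrightarrow> h differentiable (at y)"
      by (rule local_solve_last[OF der cont]) blast
    define S where "S = {z. (z, 0) \<in> V \<and> h (z, 0) \<in> B}"
    have ex: "\<exists>k'. ((\<lambda>z. f (h (z, 0))) has_derivative k') (at z) \<and> \<not> surj k'" if "z \<in> S" for z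
    proof -
      from that N(5) obtain h' where h': "(h has_derivative h') (at (z, 0))"
        by (auto simp: S_def differentiable_def)
      from that B[of "h (z, 0)"] obtain f' where f': "(f has_derivative f') (at (h (z, 0)))" "\<not> surj f'"
        by (auto simp: S_def)
      have "((\<lambda>z. (z, 0::real)) has_derivative (\<lambda>v. (v, 0))) (at z)"
        by (intro derivative_intros)
      from has_derivative_compose[OF this h']
      have "((\<lambda>z. h (z, 0)) has_derivative (\<lambda>v. h' (v, 0))) (at z)" .
      from has_derivative_compose[OF this f'(1)]
      have "((\<lambda>z. f (h (z, 0))) has_derivative (\<lambda>v. f' (h' (v, 0)))) (at z)" .
      moreover have "\<not> surj (\<lambda>v. f' (h' (v, 0)))"
      proof
        assume "surj (\<lambda>v. f' (h' (v, 0)))"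
        then have "\<exists>v. y = f' (h' (v, 0))" for y by (rule surjD)
        then have "surj f'" unfolding surj_def by blast
        then show False using f'(2) by simp
      qed
      ultimately show ?thesis by blast
    qed
    then obtain k' where k': "\<And>z. z \<in> S \<Longrightarrow> ((\<lambda>z. f (h (z, 0))) has_derivative k' z) (at z)"
      "\<And>z. z \<in> S \<Longrightarrow> \<not> surj (k' z)" by metis
    have "negligible ((\<lambda>z. f (h (z, 0))) ` S)"
    proof (rule baby_Sard)
      show "((\<lambda>z. f (h (z, 0))) has_derivative k' z) (at z within S)" if "z \<in> S" for z
        using k'(1)[OF that] by (rule has_derivative_at_withinI)
      show "rank (matrix (k' z)) < CARD('n)" if "z \<in> S" for z
      proof -
        have "linear (k' z)" using k'(1)[OF that] by (rule has_derivative_linear)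
        then have "(*v) (matrix (k' z)) = k' z" by (simp add: fun_eq_iff matrix_works)
        then have "rank (matrix (k' z)) \<noteq> CARD('n)"
          using k'(2)[OF that] by (simp add: full_rank_surjective)
        moreover have "rank (matrix (k' z)) \<le> CARD('n)"
          using rank_bound[of "matrix (k' z)"] by simp
        ultimately show ?thesis by simp
      qed
    qed simp
    moreover have "f ` (B \<inter> N) \<subseteq> (\<lambda>z. f (h (z, 0))) ` S"
    proof
      fix y assume "y \<in> f ` (B \<inter> N)"
      then obtain x where x: "x \<in> B" "x \<in> N" "y = f x" by auto
      then have "(fst x, 0) \<in> V" "h (fst x, 0) = x" using N(4)[of x] B[of x] by auto
      then show "y \<in> (\<lambda>z. f (h (z, 0))) ` S"
        using x by (auto simp: S_def intro!: image_eqI[of _ _ "fst x"])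
    qed
    ultimately show ?thesis using N(1,2) negligible_subset by blast
  qed
  \<comment> \<open>By Lindelof, countably many of the good neighbourhoods cover
    \<open>B\<close>.\<close>
  define \<F> where "\<F> = {N. open N \<and> negligible (f ` (B \<inter> N))}"
  obtain \<F>' where F: "\<F>' \<subseteq> \<F>" "countable \<F>'" "\<Union>\<F>' = \<Union>\<F>"
    using Lindelof[of \<F>] unfolding \<F>_def by auto
  have "f ` B \<subseteq> (\<Union>N\<in>\<F>'. f ` (B \<inter> N))"
  proof
    fix y assume "y \<in> f ` B"
    then obtain x where x: "x \<in> B" "y = f x" by auto
    then have "x \<in> \<Union>\<F>" using loc[of x] unfolding \<F>_def by blast
    then show "y \<in> (\<Union>N\<in>\<F>'. f ` (B \<inter> N))" using x F(3) by auto
  qed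
  moreover have "negligible (\<Union>N\<in>\<F>'. f ` (B \<inter> N))"
    using F by (intro negligible_countable_Union) (auto simp: \<F>_def)
  ultimately show ?thesis using negligible_subset by blast
qed

lemma poly_eq_0_if_derivs_0:
  fixes p :: "real poly"
  assumes "\<And>k. poly ((pderiv ^^ k) p) x = 0"
  shows "p = 0"
  using assms
proof (induction "degree p" arbitrary: p rule: less_induct)
  case less
  show ?case
  proof (cases "degree p = 0")
    case True
    then obtain c where "p = [:c:]" by (rule degree_eq_zeroE)
    then show ?thesis using less.prems[of 0] by simp
  next
    case False
    then have "pderiv p = 0"
    proof (intro less.hyps)
      show "degree (pderiv p) < degree p" using False by (simp add: degree_pderiv)
      show "poly ((pderiv ^^ k) (pderiv p)) x = 0" for k
        using less.prems[of "Suc k"] by (simp add: funpow_swap1)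
    qed
    then show ?thesis using False by (simp add: pderiv_eq_0_iff)
  qed
qed

text \<open>Stratify the zero set by the first derivative in the last variable that does not vanish: each
  stratum lies in a smooth hypersurface, so Sard's theorem is only needed for maps between spaces
  of equal dimension.\<close>

theorem polynomial_sard:
  fixes f :: "(real ^ 'n::{finite,wellorder}) \<times> real \<Rightarrow> real ^ 'n::{finite,wellorder}"
  assumes F: "polyfam F"
    and B: "\<And>x. x \<in> B \<Longrightarrow> F (fst x) \<noteq> 0 \<and> poly (F (fst x)) (snd x) = 0 \<and>
      (\<exists>f'. (f has_derivative f') (at x) \<and> \<not> surj f')"
  shows "negligible (f ` B)"
proof -
  define G where "G k z = (pderiv ^^ k) (F z)" for k z
  define Bk where "Bk k = {x \<in> B. poly (G k (fst x)) (snd x) = 0 \<and>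
    poly (G (Suc k) (fst x)) (snd x) \<noteq> 0}" for k
  have neg: "negligible (f ` Bk k)" for k
  proof -
    have "polyfam (G k)" unfolding G_def by (rule polyfam_funpow_pderiv[OF F])
    then obtain G' where G': "\<And>x. ((\<lambda>x. poly (G k (fst x)) (snd x)) has_derivative blinfun_apply (G' x)) (at x)"
      "continuous_on UNIV G'" "\<And>x. G' x (0, 1) = poly (pderiv (G k (fst x))) (snd x)"
      by (rule polyfam_C1) blast
    show ?thesis
      by (rule negligible_image_regular_level_set[OF G'(1,2)])
        (use B in \<open>auto simp: Bk_def G'(3) G_def\<close>)
  qed
  \<comment> \<open>A point in no stratum would be a zero of infinite order of the nonzero
    polynomial \<open>F (fst x)\<close>.\<close>
  have "\<exists>k. x \<in> Bk k" if x: "x \<in> B" for x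
  proof (rule ccontr)
    assume no: "\<not> ?thesis"
    have "poly (G k (fst x)) (snd x) = 0" for k
    proof (induction k)
      case 0 show ?case using B[OF x] by (simp add: G_def)
    next
      case (Suc k) then show ?case using no x by (auto simp: Bk_def)
    qed
    then have "F (fst x) = 0" unfolding G_def by (rule poly_eq_0_if_derivs_0)
    then show False using B[OF x] by simp
  qed
  then have "f ` B \<subseteq> \<Union> (range (\<lambda>k. f ` Bk k))" by blast
  moreover have "negligible (\<Union> (range (\<lambda>k. f ` Bk k)))"
    by (rule negligible_countable_Union) (auto simp: neg)
  ultimately show ?thesis by (rule negligible_subset[rotated])
qed

section \<open>Covectors annihilating the Jacobian\<close>

text \<open>Symmetry of the discrete Laplacian. For partial sums the defect is a boundary Wronskian,
  which is what the induction proves.\<close>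

lemma sum_three_term_commute:
  fixes u w :: "nat \<Rightarrow> real"
  assumes "u 0 = 0" "w 0 = 0" "u (Suc n) = 0" "w (Suc n) = 0"
  shows "(\<Sum>k=1..n. u k * (w (k - 1) + w (Suc k))) = (\<Sum>k=1..n. w k * (u (k - 1) + u (Suc k)))"
proof -
  have "(\<Sum>k=1..m. u k * (w (k - 1) + w (Suc k))) - (\<Sum>k=1..m. w k * (u (k - 1) + u (Suc k)))
      = u m * w (Suc m) - w m * u (Suc m)" for m
    using assms by (induction m) (simp_all add: algebra_simps)
  from this[of n] assms show ?thesis by simp
qed

text \<open>\<open>jacobi_covector\<close> says that \<open>(w, s)\<close> annihilates the derivatives of \<open>H\<close> with respect to the
  eigenvector \<open>v\<close> and the eigenvalue; \<open>T\<close> stands for \<open>t \<beta>\<close>, and \<open>g\<close> is the diagonal of the Jacobi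
  matrix having \<open>v\<close> in its kernel, cubic term included.\<close>

definition jacobi_covector ::
    "real \<Rightarrow> (nat \<Rightarrow> real) \<Rightarrow> real \<Rightarrow> nat \<Rightarrow> (nat \<Rightarrow> real) \<Rightarrow> (nat \<Rightarrow> real) \<Rightarrow> real \<Rightarrow> bool" where
  "jacobi_covector c g T n v w s \<longleftrightarrow>
     w 0 = 0 \<and> w (Suc n) = 0 \<and> (\<Sum>k=1..n. w k * v k) = 0 \<and>
     (\<forall>k\<in>{1..n}. (g k + 2 * T * (v k)^2) * w k = c * (w (k - 1) + w (Suc k)) + s * v k)"

text \<open>Test the equation of \<open>w\<close> against \<open>v\<close> and that of
  \<open>v\<close> against \<open>w\<close>. The couplings cancel by symmetry; of the linearised
  cubic \<open>3 T v^2\<close> only the excess \<open>2 T v^2\<close> over the part inside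
  \<open>g\<close> remains.\<close>

lemma jacobi_covector_cubic_sum:
  assumes v: "jacobi_solution c g n v" and w: "jacobi_covector c g T n v w s"
  shows "2 * T * (\<Sum>k=1..n. (v k)^3 * w k) = s * (\<Sum>k=1..n. (v k)^2)"
proof -
  have "c * (\<Sum>k=1..n. w k * (v (k - 1) + v (Suc k))) = (\<Sum>k=1..n. w k * (g k * v k))"
    unfolding sum_distrib_left
    by (intro sum.cong) (use v in \<open>auto simp: jacobi_solution_def\<close>)
  moreover have "c * (\<Sum>k=1..n. v k * (w (k - 1) + w (Suc k)))
      = (\<Sum>k=1..n. v k * ((g k + 2 * T * (v k)^2) * w k - s * v k))"
    unfolding sum_distrib_left
    by (intro sum.cong) (use w in \<open>auto simp: jacobi_covector_def\<close>)
  moreover have "(\<Sum>k=1..n. v k * (w (k - 1) + w (Suc k))) = (\<Sum>k=1..n. w k * (v (k - 1) + v (Suc k)))"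
    by (rule sum_three_term_commute) (use v w in \<open>auto simp: jacobi_solution_def jacobi_covector_def\<close>)
  ultimately have "(\<Sum>k=1..n. v k * ((g k + 2 * T * (v k)^2) * w k - s * v k))
      = (\<Sum>k=1..n. w k * (g k * v k))" by simp
  then show ?thesis
    by (simp add: algebra_simps power2_eq_square power3_eq_cube sum.distrib sum_subtractf sum_distrib_left)
qed

lemma jacobi_solution_sum_squares_pos:
  assumes "jacobi_solution c g n v" "n \<ge> 1"
  shows "(\<Sum>k=1..n. (v k)^2) > 0"
proof -
  have "(v 1)^2 > 0" using assms by (simp add: jacobi_solution_def)
  also have "(v 1)^2 \<le> (\<Sum>k=1..n. (v k)^2)"
    using assms(2) by (intro member_le_sum) auto
  finally show ?thesis .
qed

text \<open>Simplicity of Jacobi eigenvalues: without cubic contribution the pairing with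
  \<open>v\<close> gives \<open>s = 0\<close>, so \<open>w\<close> is proportional to
  \<open>v\<close> and, being orthogonal to it, vanishes.\<close>

lemma jacobi_covector_eq_0:
  assumes c: "c > 0" and n: "n \<ge> 1"
    and v: "jacobi_solution c g n v" and w: "jacobi_covector c g T n v w s"
    and cubic: "\<And>k. k \<in> {1..n} \<Longrightarrow> T * (v k)^2 * w k = 0" and k: "k \<le> n"
  shows "w k = 0"
proof -
  have v1: "v 1 \<noteq> 0" using v by (simp add: jacobi_solution_def)
  have "2 * T * (\<Sum>k=1..n. (v k)^3 * w k) = 2 * (\<Sum>k=1..n. v k * (T * (v k)^2 * w k))"
    by (simp add: sum_distrib_left power2_eq_square power3_eq_cube algebra_simps)
  also have "\<dots> = 0" using cubic by (simp add: sum.neutral)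
  finally have "s * (\<Sum>k=1..n. (v k)^2) = 0"
    using jacobi_covector_cubic_sum[OF v w] by argo
  then have s: "s = 0" using jacobi_solution_sum_squares_pos[OF v n] by auto
  have ratio: "v 1 * w k = w 1 * v k" if "k \<le> Suc n" for k
  proof (rule three_term_proportional[where c = c and g = g and n = n])
    show "g k * w k = c * (w (k - 1) + w (Suc k))" if "k \<in> {1..n}" for k
    proof -
      have "(g k + 2 * T * (v k)^2) * w k = c * (w (k - 1) + w (Suc k))"
        using w that s by (simp add: jacobi_covector_def)
      then show ?thesis using cubic[OF that] by algebra
    qed
  qed (use c v w that in \<open>auto simp: jacobi_solution_def jacobi_covector_def\<close>)
  have "w 1 * (\<Sum>k=1..n. (v k)^2) = (\<Sum>k=1..n. (w 1 * v k) * v k)"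
    by (simp add: sum_distrib_left power2_eq_square mult.assoc)
  also have "\<dots> = (\<Sum>k=1..n. (v 1 * w k) * v k)"
    by (intro sum.cong refl) (metis ratio atLeastAtMost_iff le_SucI)
  also have "\<dots> = v 1 * (\<Sum>k=1..n. w k * v k)"
    by (simp add: sum_distrib_left mult.assoc)
  also have "\<dots> = 0" using w by (simp add: jacobi_covector_def)
  finally have "w 1 = 0" using jacobi_solution_sum_squares_pos[OF v n] by auto
  then show ?thesis using ratio[of k] k v1 by auto
qed

text \<open>The eigenvector divided by its first entry, a scaling that turns \<open>T\<close> into
  \<open>\<tau> = T * (v 1)^2\<close>. It is defined over a ring so that it runs on reals and on
  polynomials in \<open>\<tau>\<close> alike.\<close>

fun cubic_rec :: "'a::comm_ring_1 \<Rightarrow> (nat \<Rightarrow> 'a) \<Rightarrow> 'a \<Rightarrow> nat \<Rightarrow> 'a" where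
  "cubic_rec r z \<tau> 0 = 0"
| "cubic_rec r z \<tau> (Suc 0) = 1"
| "cubic_rec r z \<tau> (Suc (Suc k)) =
     r * ((z (Suc k) + \<tau> * (cubic_rec r z \<tau> (Suc k))^2) * cubic_rec r z \<tau> (Suc k)) - cubic_rec r z \<tau> k"

fun linear_rec :: "'a::comm_ring_1 \<Rightarrow> (nat \<Rightarrow> 'a) \<Rightarrow> (nat \<Rightarrow> 'a) \<Rightarrow> 'a \<Rightarrow> nat \<Rightarrow> 'a" where
  "linear_rec r g b a 0 = 0"
| "linear_rec r g b a (Suc 0) = a"
| "linear_rec r g b a (Suc (Suc k)) =
     r * (g (Suc k) * linear_rec r g b a (Suc k) - b (Suc k)) - linear_rec r g b a k"

lemma poly_cubic_rec:
  "poly (cubic_rec r z p k) x = cubic_rec (poly r x) (\<lambda>k. poly (z k) x) (poly p x) k"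
  by (induction r z p k rule: cubic_rec.induct) simp_all

lemma poly_linear_rec:
  "poly (linear_rec r g b a k) x =
    linear_rec (poly r x) (\<lambda>k. poly (g k) x) (\<lambda>k. poly (b k) x) (poly a x) k"
  by (induction r g b a k rule: linear_rec.induct) simp_all

lemma polyfam_cubic_rec:
  assumes "\<And>k. polyfam (\<lambda>z. Z z k)"
  shows "polyfam (\<lambda>z. cubic_rec r (Z z) p k)"
proof (induction k rule: less_induct)
  case (less k)
  consider "k = 0" | "k = 1" | j where "k = Suc (Suc j)"
    by (metis One_nat_def not0_implies_Suc)
  then show ?case
  proof cases
    case 3
    then show ?thesis using less.IH[of j] less.IH[of "Suc j"] assms
      by (auto intro!: polyfam.intros polyfam_diff polyfam_power)
  qed (auto intro: polyfam.const)
qed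

lemma polyfam_linear_rec:
  assumes "\<And>k. polyfam (\<lambda>z. g z k)" "\<And>k. polyfam (\<lambda>z. b z k)"
  shows "polyfam (\<lambda>z. linear_rec r (g z) (b z) a k)"
proof (induction k rule: less_induct)
  case (less k)
  consider "k = 0" | "k = 1" | j where "k = Suc (Suc j)"
    by (metis One_nat_def not0_implies_Suc)
  then show ?case
  proof cases
    case 3
    then show ?thesis using less.IH[of j] less.IH[of "Suc j"] assms
      by (auto intro!: polyfam.intros polyfam_diff)
  qed (auto intro: polyfam.const)
qed

text \<open>Up to its last equation, a covector is a combination of two explicit solutions \<open>y, x\<close> of the
  linearised recurrence.  The last equation (in the form of \<open>jacobi_covector_cubic_sum\<close>) and the
  orthogonality to \<open>v\<close> are two linear equations for the two coefficients, with this determinant.\<close>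

definition degeneracy :: "'a::comm_ring_1 \<Rightarrow> (nat \<Rightarrow> 'a) \<Rightarrow> 'a \<Rightarrow> nat \<Rightarrow> 'a" where
  "degeneracy r z \<tau> n = (let
      u = cubic_rec r z \<tau>;
      g = (\<lambda>k. z k + 3 * \<tau> * (u k)^2);
      y = linear_rec r g (\<lambda>_. 0) 1;
      x = linear_rec r g u 0
    in (\<Sum>k=1..n. y k * u k) * (2 * \<tau> * (\<Sum>k=1..n. (u k)^3 * x k) - (\<Sum>k=1..n. (u k)^2)) -
       (\<Sum>k=1..n. x k * u k) * (2 * \<tau> * (\<Sum>k=1..n. (u k)^3 * y k)))"

lemma poly_degeneracy:
  "poly (degeneracy r z p n) x = degeneracy (poly r x) (\<lambda>k. poly (z k) x) (poly p x) n"
  by (simp add: degeneracy_def Let_def poly_sum poly_cubic_rec poly_linear_rec)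

lemma polyfam_degeneracy:
  assumes "\<And>k. polyfam (\<lambda>z. Z z k)"
  shows "polyfam (\<lambda>z. degeneracy r (Z z) p n)"
proof -
  have u: "polyfam (\<lambda>z. cubic_rec r (Z z) p k)" for k by (rule polyfam_cubic_rec[OF assms])
  have x: "polyfam (\<lambda>z. linear_rec r (\<lambda>k. Z z k + 3 * p * (cubic_rec r (Z z) p k)^2)
      (cubic_rec r (Z z) p) 0 k)" for k
    by (intro polyfam_linear_rec polyfam.intros polyfam_power u assms)
  have y: "polyfam (\<lambda>z. linear_rec r (\<lambda>k. Z z k + 3 * p * (cubic_rec r (Z z) p k)^2)
      (\<lambda>_. 0) 1 k)" for k
    by (intro polyfam_linear_rec polyfam.intros polyfam_power u assms)
  show ?thesis unfolding degeneracy_def Let_def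
    by (intro polyfam_diff polyfam.mult polyfam_sum polyfam.const polyfam_power u x y)
qed

text \<open>At \<open>\<tau> = 0\<close> the linearised recurrence is the original one, so
  \<open>y = u\<close> and the determinant collapses to minus the square of the sum of the
  \<open>u k ^ 2\<close>.\<close>

lemma degeneracy_0_neq_0:
  fixes r :: real
  assumes "n \<ge> 1"
  shows "degeneracy r z 0 n \<noteq> 0"
proof -
  have eq: "linear_rec r z (\<lambda>_. 0) 1 k = cubic_rec r z 0 k" for k
    by (induction k rule: linear_rec.induct[of "\<lambda>_ _ _ _ k. linear_rec r z (\<lambda>_. 0) 1 k = cubic_rec r z 0 k"])
      simp_all
  have "(cubic_rec r z 0 1)^2 \<le> (\<Sum>k=1..n. (cubic_rec r z 0 k)^2)"
    using assms by (intro member_le_sum) auto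
  then have "(\<Sum>k=1..n. (cubic_rec r z 0 k)^2) > 0" by simp
  then show ?thesis by (simp add: degeneracy_def Let_def eq power2_eq_square)
qed

text \<open>The value at \<open>n\<close> comes from row \<open>n - 1\<close>, hence the range
  \<open>{1..<n}\<close> for \<open>z\<close>; row \<open>n\<close> is left over to determine the
  last potential.\<close>

lemma jacobi_solution_cubic_rec:
  assumes c: "c \<noteq> 0" and v: "jacobi_solution c g n v"
    and z: "\<And>k. k \<in> {1..<n} \<Longrightarrow> z k = g k - T * (v k)^2" and "k \<le> n"
  shows "v k = v 1 * cubic_rec (1 / c) z (T * (v 1)^2) k"
  using \<open>k \<le> n\<close>
proof (induction k rule: less_induct)
  case (less k)
  consider "k = 0" | "k = 1" | j where "k = Suc (Suc j)"
    by (metis One_nat_def not0_implies_Suc)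
  then show ?case
  proof cases
    case 1 then show ?thesis using v by (simp add: jacobi_solution_def)
  next
    case 3
    define u where "u = cubic_rec (1 / c) z (T * (v 1)^2)"
    have j: "Suc j \<in> {1..n}" "Suc j \<in> {1..<n}" using less.prems 3 by auto
    have IH: "v j = v 1 * u j" "v (Suc j) = v 1 * u (Suc j)"
      using less.IH[of j] less.IH[of "Suc j"] 3 less.prems by (auto simp: u_def)
    have "g (Suc j) * v (Suc j) = c * (v j + v k)"
      using v j 3 by (auto simp: jacobi_solution_def dest!: bspec[where x = "Suc j"])
    then have "v k = 1 / c * (g (Suc j) * v (Suc j)) - v j" using c by (simp add: field_simps)
    also have "\<dots> = 1 / c * ((z (Suc j) + T * (v (Suc j))^2) * v (Suc j)) - v j"
      by (simp add: z[OF j(2)])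
    also have "\<dots> = v 1 * u k"
      unfolding 3 u_def cubic_rec.simps unfolding IH u_def[symmetric]
      by (simp add: algebra_simps power2_eq_square)
    finally show ?thesis by (simp add: u_def)
  qed auto
qed

text \<open>Superposition: rows below \<open>n\<close> depend linearly on \<open>w 1\<close> and on
  the source \<open>s * v\<close>, which is \<open>s * v1\<close> times \<open>u\<close>.\<close>

lemma jacobi_covector_linear_rec:
  assumes c: "c \<noteq> 0" and w: "jacobi_covector c g T n v w s"
    and u: "\<And>k. k \<in> {1..n} \<Longrightarrow> v k = v1 * u k"
    and G: "\<And>k. k \<in> {1..<n} \<Longrightarrow> G k = g k + 2 * T * (v k)^2" and "k \<le> n"
  shows "w k = w 1 * linear_rec (1 / c) G (\<lambda>_. 0) 1 k + s * v1 * linear_rec (1 / c) G u 0 k"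
  using \<open>k \<le> n\<close>
proof (induction k rule: less_induct)
  case (less k)
  consider "k = 0" | "k = 1" | j where "k = Suc (Suc j)"
    by (metis One_nat_def not0_implies_Suc)
  then show ?case
  proof cases
    case 1 then show ?thesis using w by (simp add: jacobi_covector_def)
  next
    case 3
    have j: "Suc j \<in> {1..n}" "Suc j \<in> {1..<n}" using less.prems 3 by auto
    have "G (Suc j) * w (Suc j) = c * (w j + w k) + s * (v1 * u (Suc j))"
      using w j 3 u[OF j(1)] G[OF j(2)]
      by (auto simp: jacobi_covector_def dest!: bspec[where x = "Suc j"])
    then have "w k = 1 / c * (G (Suc j) * w (Suc j) - s * v1 * u (Suc j)) - w j"
      using c by (simp add: field_simps)
    also have "w (Suc j) = w 1 * linear_rec (1 / c) G (\<lambda>_. 0) 1 (Suc j) +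
        s * v1 * linear_rec (1 / c) G u 0 (Suc j)"
      using less.IH[of "Suc j"] 3 less.prems by auto
    also have "w j = w 1 * linear_rec (1 / c) G (\<lambda>_. 0) 1 j + s * v1 * linear_rec (1 / c) G u 0 j"
      using less.IH[of j] 3 less.prems by auto
    finally show ?thesis
      unfolding 3 linear_rec.simps by algebra
  qed auto
qed

lemma two_linear_equations_det_0:
  fixes p q :: real
  assumes "p * a1 + q * b1 = 0" "p * a2 + q * b2 = 0" "p \<noteq> 0 \<or> q \<noteq> 0"
  shows "a1 * b2 - b1 * a2 = 0"
proof -
  have "p * (a1 * b2 - b1 * a2) = 0" "q * (a1 * b2 - b1 * a2) = 0"
    using assms(1,2) by algebra+
  then show ?thesis using assms(3) by auto
qed

lemma jacobi_covector_degeneracy_eq_0: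
  assumes c: "c \<noteq> 0" and n: "n \<ge> 1"
    and v: "jacobi_solution c g n v" and w: "jacobi_covector c g T n v w s"
    and nz: "\<exists>k\<le>n. w k \<noteq> 0"
    and z: "\<And>k. k \<in> {1..<n} \<Longrightarrow> z k = g k - T * (v k)^2"
  shows "degeneracy (1 / c) z (T * (v 1)^2) n = 0"
proof -
  define \<tau> where "\<tau> = T * (v 1)^2"
  define u where "u = cubic_rec (1 / c) z \<tau>"
  \<comment> \<open>The diagonal of the linearisation: \<open>g + 2 T v^2\<close> with
    \<open>g = z + T v^2\<close>, hence the factor 3.\<close>
  define G where "G k = z k + 3 * \<tau> * (u k)^2" for k
  define y where "y = linear_rec (1 / c) G (\<lambda>_. 0) 1"
  define x where "x = linear_rec (1 / c) G u 0"
  have v1: "v 1 \<noteq> 0" using v by (simp add: jacobi_solution_def)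
  have uk: "u k = v k / v 1" if "k \<le> n" for k
    using jacobi_solution_cubic_rec[OF c v z that] v1 by (simp add: u_def \<tau>_def)
  have wk: "w k = w 1 * y k + s * v 1 * x k" if "k \<le> n" for k
    unfolding y_def x_def
  proof (rule jacobi_covector_linear_rec[OF c w _ _ that])
    show "G k = g k + 2 * T * (v k)^2" if "k \<in> {1..<n}" for k
      using that v1 by (simp add: G_def z \<tau>_def uk power2_eq_square)
  qed (use uk v1 in auto)
  have "v 1 * (\<Sum>k=1..n. w k * u k) = (\<Sum>k=1..n. w k * v k)"
    unfolding sum_distrib_left by (intro sum.cong) (use v1 in \<open>auto simp: uk\<close>)
  then have "(\<Sum>k=1..n. w k * u k) = 0" using w v1 by (simp add: jacobi_covector_def)
  moreover have "(\<Sum>k=1..n. w k * u k) = (\<Sum>k=1..n. (w 1 * y k + s * v 1 * x k) * u k)"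
    by (intro sum.cong refl) (metis wk atLeastAtMost_iff)
  ultimately have A: "w 1 * (\<Sum>k=1..n. y k * u k) + (s * v 1) * (\<Sum>k=1..n. x k * u k) = 0"
    by (simp add: sum.distrib sum_distrib_left algebra_simps)
  have "2 * T * (\<Sum>k=1..n. (v k)^3 * w k) = s * (\<Sum>k=1..n. (v k)^2)"
    by (rule jacobi_covector_cubic_sum[OF v w])
  moreover have "(\<Sum>k=1..n. (v k)^3 * w k) = (v 1)^3 * (\<Sum>k=1..n. (u k)^3 * w k)"
    unfolding sum_distrib_left by (intro sum.cong) (use v1 in \<open>auto simp: uk power_divide\<close>)
  moreover have "(\<Sum>k=1..n. (v k)^2) = (v 1)^2 * (\<Sum>k=1..n. (u k)^2)"
    unfolding sum_distrib_left by (intro sum.cong) (use v1 in \<open>auto simp: uk power_divide\<close>)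
  ultimately have "v 1 * (2 * \<tau> * (\<Sum>k=1..n. (u k)^3 * w k)) = v 1 * (s * v 1 * (\<Sum>k=1..n. (u k)^2))"
    by (simp add: \<tau>_def power2_eq_square power3_eq_cube algebra_simps)
  then have "2 * \<tau> * (\<Sum>k=1..n. (u k)^3 * w k) = s * v 1 * (\<Sum>k=1..n. (u k)^2)"
    using v1 by simp
  moreover have "(\<Sum>k=1..n. (u k)^3 * w k) = (\<Sum>k=1..n. (u k)^3 * (w 1 * y k + s * v 1 * x k))"
    by (intro sum.cong refl) (metis wk atLeastAtMost_iff)
  moreover have "\<dots> = w 1 * (\<Sum>k=1..n. (u k)^3 * y k) + s * v 1 * (\<Sum>k=1..n. (u k)^3 * x k)"
    by (simp add: sum.distrib sum_distrib_left algebra_simps)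
  ultimately have "2 * \<tau> * (w 1 * (\<Sum>k=1..n. (u k)^3 * y k) + s * v 1 * (\<Sum>k=1..n. (u k)^3 * x k))
      = s * v 1 * (\<Sum>k=1..n. (u k)^2)" by simp
  then have B: "w 1 * (2 * \<tau> * (\<Sum>k=1..n. (u k)^3 * y k)) +
      (s * v 1) * (2 * \<tau> * (\<Sum>k=1..n. (u k)^3 * x k) - (\<Sum>k=1..n. (u k)^2)) = 0"
    by (simp add: algebra_simps)
  have "w 1 \<noteq> 0 \<or> s * v 1 \<noteq> 0" using nz wk by force
  from two_linear_equations_det_0[OF A B this] show ?thesis
    unfolding degeneracy_def Let_def \<tau>_def[symmetric] u_def[symmetric] G_def[abs_def, symmetric]
      y_def[symmetric] x_def[symmetric] .
qed

section \<open>Vectors as sequences\<close>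

text \<open>The value is \<open>0\<close> outside \<open>1, \<dots>, CARD('n)\<close>: these are the boundary conditions.\<close>

definition seq :: "real ^ 'n::{finite,wellorder} \<Rightarrow> nat \<Rightarrow> real" where
  "seq \<phi> k = \<phi> \<bullet> (\<chi> j. of_bool (pos j = k))"

lemma inj_pos: "inj (pos :: 'n::{finite,wellorder} \<Rightarrow> nat)"
proof (rule linorder_injI)
  fix i j :: 'n assume "i < j"
  then have "{..i} \<subset> {..j}" by auto
  then have "pos i < pos j" unfolding pos_def by (intro psubset_card_mono) auto
  then show "pos i \<noteq> pos j" by simp
qed

lemma pos_bounds: "pos (i :: 'n::{finite,wellorder}) \<in> {1..CARD('n)}"
proof -
  have "card {..i} \<le> CARD('n)" by (intro card_mono) auto
  moreover have "card {..i} > 0" by (auto simp: card_gt_0_iff)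
  ultimately show ?thesis by (simp add: pos_def)
qed

lemma bij_betw_pos: "bij_betw (pos :: 'n::{finite,wellorder} \<Rightarrow> nat) UNIV {1..CARD('n)}"
proof -
  have "range (pos :: 'n \<Rightarrow> nat) = {1..CARD('n)}"
    by (rule card_subset_eq) (use pos_bounds[where 'n = 'n] in \<open>auto simp: card_image inj_pos\<close>)
  then show ?thesis using inj_pos by (simp add: bij_betw_def)
qed

lemma ball_pos: "(\<forall>k\<in>{1..CARD('n::{finite,wellorder})}. P k) \<longleftrightarrow> (\<forall>i::'n. P (pos i))"
  using bij_betw_pos[where 'n = 'n] unfolding bij_betw_def by (metis rangeE rangeI)

lemma sum_pos: "(\<Sum>i\<in>UNIV. f (pos (i::'n::{finite,wellorder}))) = (\<Sum>k=1..CARD('n). f k)"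
  by (rule sum.reindex_bij_betw[OF bij_betw_pos])

lemma seq_eq_sum: "seq \<phi> k = (\<Sum>j\<in>UNIV. if pos j = k then \<phi> $ j else 0)"
  unfolding seq_def inner_vec_def by (intro sum.cong) auto

lemma seq_pos [simp]: "seq \<phi> (pos i) = \<phi> $ i"
  by (simp add: seq_eq_sum inj_eq[OF inj_pos])

lemma seq_outside: "k \<notin> {1..CARD('n)} \<Longrightarrow> seq (\<phi> :: real ^ 'n::{finite,wellorder}) k = 0"
  unfolding seq_eq_sum using pos_bounds by (intro sum.neutral) auto

lemma seq_0 [simp]: "seq \<phi> 0 = 0" and seq_Suc_card [simp]: "seq (\<phi> :: real ^ 'n::{finite,wellorder}) (Suc CARD('n)) = 0"
  by (simp_all add: seq_outside)

lemma inner_seq: "(\<phi> :: real ^ 'n::{finite,wellorder}) \<bullet> \<psi> = (\<Sum>k=1..CARD('n). seq \<phi> k * seq \<psi> k)"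
  unfolding inner_vec_def sum_pos[where 'n = 'n, symmetric] by simp

lemma vec_eq_0_iff_seq: "(\<phi> :: real ^ 'n::{finite,wellorder}) = 0 \<longleftrightarrow> (\<forall>k\<in>{1..CARD('n)}. seq \<phi> k = 0)"
  unfolding ball_pos by (simp add: vec_eq_iff)

section \<open>The discretised operator\<close>

text \<open>The off-diagonal entries of \<open>D\<close> next to the diagonal are
  \<open>- coupling\<close>; the factor 2 is that of the kinetic term
  \<open>1/2 * D1\<close>.\<close>

definition coupling :: "'n itself \<Rightarrow> real \<Rightarrow> real \<Rightarrow> real" where
  "coupling n a b = 1 / (2 * (mesh n a b)^2)"

definition diagonal :: "real \<Rightarrow> real \<Rightarrow> real ^ 'n::{finite,wellorder}" where
  "diagonal a b = (\<chi> i. 1 / (mesh TYPE('n::{finite,wellorder}) a b)^2 + V (node a b i))"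

lemma mesh_pos: "a < b \<Longrightarrow> mesh n a b > 0"
  unfolding mesh_def by (intro divide_pos_pos) auto

lemma coupling_pos: "a < b \<Longrightarrow> coupling n a b > 0"
  using mesh_pos[of a b n] by (simp add: coupling_def)

lemma diag_mult_nth [simp]: "(diag K *v \<phi>) $ i = K $ i * \<phi> $ i"
  by (simp add: matrix_vector_mult_def diag_def if_distrib[of "\<lambda>x. x * _"] cong: if_cong)

lemma D_mult_nth:
  "(D a b *v (\<phi> :: real ^ 'n::{finite,wellorder})) $ i = diagonal a b $ i * \<phi> $ i
     - coupling TYPE('n) a b * (seq \<phi> (pos i - 1) + seq \<phi> (Suc (pos i)))"
proof -
  have "diag (\<chi> j. V (node a b j)) *v \<phi> = (\<chi> i. V (node a b i) * \<phi> $ i)"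
    by (simp add: vec_eq_iff)
  moreover have "(((1/2) *\<^sub>R D1 a b) *v \<phi>) $ i = 1 / (mesh TYPE('n) a b)^2 * \<phi> $ i
      - coupling TYPE('n) a b * (seq \<phi> (pos i - 1) + seq \<phi> (Suc (pos i)))"
  proof -
    \<comment> \<open>Positions start at 1, so for \<open>pos i = 1\<close> no index has position
      \<open>pos i - 1 = 0\<close>, in accordance with the boundary value.\<close>
    have e: "pos j = pos i - 1 \<longleftrightarrow> pos i = Suc (pos j)" for j :: 'n
      using pos_bounds[of i] pos_bounds[of j] by auto
    have "(((1/2) *\<^sub>R D1 a b) *v \<phi>) $ i =
        (\<Sum>j\<in>UNIV. (if j = i then 1 / (mesh TYPE('n) a b)^2 * \<phi> $ j else 0)
          - coupling TYPE('n) a b * ((if pos j = pos i - 1 then \<phi> $ j else 0)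
             + (if pos j = Suc (pos i) then \<phi> $ j else 0)))"
      unfolding matrix_vector_mult_def e
      by (auto simp: D1_def coupling_def divide_simps intro!: sum.cong)
    also have "\<dots> = (\<Sum>j\<in>UNIV. if j = i then 1 / (mesh TYPE('n) a b)^2 * \<phi> $ j else 0)
        - coupling TYPE('n) a b * (seq \<phi> (pos i - 1) + seq \<phi> (Suc (pos i)))"
      unfolding sum_subtractf sum_distrib_left[symmetric] sum.distrib seq_eq_sum ..
    finally show ?thesis by simp
  qed
  ultimately show ?thesis
    by (simp add: D_def matrix_vector_mult_add_rdistrib diagonal_def distrib_right)
qed

lemma D_symmetric: "x \<bullet> (D a b *v y) = (D a b *v x) \<bullet> (y :: real ^ 'n::{finite,wellorder})"
proof -
  have "transpose (D a b) = (D a b :: real ^ 'n::{finite,wellorder} ^ 'n::{finite,wellorder})"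
    by (auto simp: D_def D1_def diag_def transpose_def vec_eq_iff)
  then show ?thesis by (metis dot_lmul_matrix transpose_matrix_vector)
qed

text \<open>Diagonal of the Jacobi matrix whose eigenvector is \<open>\<phi>\<close>, shifted by the eigenvalue.\<close>

definition jacobi_diag ::
    "real \<Rightarrow> real \<Rightarrow> real \<Rightarrow> real ^ 'n::{finite,wellorder} \<Rightarrow> 'n::{finite,wellorder} point \<Rightarrow> nat \<Rightarrow> real" where
  "jacobi_diag a b \<beta> K = (\<lambda>(\<phi>, l, t) k.
     (1 - t) * seq K k + seq (diagonal a b :: real ^ 'n::{finite,wellorder}) k + t * \<beta> * (seq \<phi> k)^2 - l)"

text \<open>Reading the cubic term as \<open>t * \<beta> * (seq \<phi> k)^2\<close> times
  \<open>seq \<phi> k\<close> moves it into the diagonal, so each zero of the nonlinear problem is a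
  kernel vector of a linear Jacobi matrix.\<close>

lemma H_eq_0_iff:
  fixes \<phi> K :: "real ^ 'n::{finite,wellorder}"
  shows "H a b \<beta> K (\<phi>, l, t) = 0 \<longleftrightarrow>
    (\<forall>k\<in>{1..CARD('n)}. jacobi_diag a b \<beta> K (\<phi>, l, t) k * seq \<phi> k =
       coupling TYPE('n) a b * (seq \<phi> (k - 1) + seq \<phi> (Suc k))) \<and>
    \<phi> \<bullet> \<phi> = 1 / mesh TYPE('n) a b"
  unfolding ball_pos H_def jacobi_diag_def
  by (auto simp: prod_eq_iff vec_eq_iff D_mult_nth cube_def algebra_simps power2_eq_square power3_eq_cube)

lemma H_zero_jacobi_solution:
  fixes \<phi> K :: "real ^ 'n::{finite,wellorder}"
  assumes ab: "a < b" and H: "H a b \<beta> K (\<phi>, l, t) = 0"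
  shows "jacobi_solution (coupling TYPE('n) a b) (jacobi_diag a b \<beta> K (\<phi>, l, t)) CARD('n) (seq \<phi>)"
proof -
  note rec = H[unfolded H_eq_0_iff, THEN conjunct1, rule_format]
  \<comment> \<open>A vanishing first entry would propagate to \<open>\<phi> = 0\<close>, against
    the normalisation.\<close>
  have "seq \<phi> 1 \<noteq> 0"
  proof
    assume 1: "seq \<phi> 1 = 0"
    have "seq \<phi> k = 0 \<and> seq \<phi> (Suc k) = 0" if "k \<le> CARD('n)" for k
      using that
    proof (induction k)
      case (Suc k)
      then have "coupling TYPE('n) a b * seq \<phi> (Suc (Suc k)) = 0"
        using rec[of "Suc k"] by simp
      then show ?case using Suc coupling_pos[OF ab, of "TYPE('n)"] by auto
    qed (use 1 in simp)
    then have "\<phi> = 0" unfolding vec_eq_0_iff_seq by auto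
    then show False using H mesh_pos[OF ab, of "TYPE('n)"] by (simp add: H_eq_0_iff)
  qed
  then show ?thesis using rec by (simp add: jacobi_solution_def)
qed

section \<open>The Jacobian of the homotopy\<close>

definition H_deriv :: "real \<Rightarrow> real \<Rightarrow> real \<Rightarrow> real ^ 'n::{finite,wellorder} \<Rightarrow> 'n::{finite,wellorder} point \<Rightarrow>
    'n::{finite,wellorder} point \<Rightarrow> (real ^ 'n::{finite,wellorder}) \<times> real" where
  "H_deriv a b \<beta> K = (\<lambda>(\<phi>, l, t) (y, m, r).
     ((1 - t) *\<^sub>R (diag K *v y) + D a b *v y + (3 * t * \<beta>) *\<^sub>R (\<chi> i. (\<phi> $ i)^2 * y $ i)
        - l *\<^sub>R y - m *\<^sub>R \<phi> + r *\<^sub>R (\<beta> *\<^sub>R cube \<phi> - diag K *v \<phi>),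
      - (\<phi> \<bullet> y)))"

lemma has_derivative_vec_componentwise:
  fixes f :: "'a::real_normed_vector \<Rightarrow> real ^ 'm"
  assumes "\<And>i. ((\<lambda>x. f x $ i) has_derivative (\<lambda>x. f' x $ i)) (at a within S)"
  shows "(f has_derivative f') (at a within S)"
  using assms by (subst has_derivative_componentwise_within) (auto simp: Basis_vec_def inner_axis)

lemma has_derivative_cube:
  "(cube has_derivative (\<lambda>y. \<chi> i. 3 * (\<phi> $ i)^2 * y $ i)) (at (\<phi> :: real ^ 'n))"
proof (rule has_derivative_vec_componentwise)
  fix i :: 'n
  have "((\<lambda>\<phi>. (\<phi> $ i)^3) has_derivative (\<lambda>y. 3 * (\<phi> $ i)^2 * y $ i)) (at \<phi>)"
    by (auto intro!: derivative_eq_intros bounded_linear_imp_has_derivative bounded_linear_vec_nth)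
  then show "((\<lambda>\<phi>. cube \<phi> $ i) has_derivative (\<lambda>y. (\<chi> i. 3 * (\<phi> $ i)^2 * y $ i) $ i)) (at \<phi>)"
    by (simp add: cube_def)
qed

lemma has_derivative_H:
  fixes p :: "'n::{finite,wellorder} point"
  shows "(H a b \<beta> K has_derivative H_deriv a b \<beta> K p) (at p)"
proof -
  obtain \<phi> l t where p: "p = (\<phi>, l, t)" by (cases p) auto
  have H: "H a b \<beta> K = (\<lambda>p. ((1 - snd (snd p)) *\<^sub>R (diag K *v fst p) + D a b *v fst p
      + (snd (snd p) * \<beta>) *\<^sub>R cube (fst p) - fst (snd p) *\<^sub>R fst p,
      1/2 * (1 / mesh TYPE('n) a b - fst p \<bullet> fst p)))"
    by (auto simp: H_def)
  have lin: "((\<lambda>p::'n::{finite,wellorder} point. A *v fst p) has_derivative (\<lambda>v. A *v fst v)) (at p)" for A :: "real ^ 'n::{finite,wellorder} ^ 'n::{finite,wellorder}"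
    by (intro bounded_linear_imp_has_derivative bounded_linear_compose[OF matrix_vector_mul_bounded_linear bounded_linear_fst])
  have cub: "((\<lambda>p::'n::{finite,wellorder} point. cube (fst p)) has_derivative (\<lambda>v. \<chi> i. 3 * (fst p $ i)^2 * fst v $ i)) (at p)"
    by (rule has_derivative_compose[OF has_derivative_fst[OF has_derivative_ident] has_derivative_cube])
  have fs: "((\<lambda>p::'n::{finite,wellorder} point. fst (snd p)) has_derivative (\<lambda>v. fst (snd v))) (at p)"
    and ss: "((\<lambda>p::'n::{finite,wellorder} point. snd (snd p)) has_derivative (\<lambda>v. snd (snd v))) (at p)"
    by (intro derivative_intros)+
  show ?thesis
    unfolding H
    by (rule derivative_eq_intros lin cub fs ss refl | simp)+
      (auto simp: fun_eq_iff H_deriv_def p prod_eq_iff vec_eq_iff cube_def inner_commute algebra_simps)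
qed

lemma exists_annihilating_covector:
  fixes L :: "'a::euclidean_space \<Rightarrow> 'b::euclidean_space"
  assumes "linear L" "\<not> surj L"
  obtains w where "w \<noteq> 0" "\<And>y. w \<bullet> L y = 0"
proof -
  have "span (range L) = range L"
    using linear_subspace_image[OF assms(1) subspace_UNIV] by (simp add: span_eq_iff)
  then have "span (range L) \<noteq> UNIV" using assms(2) by metis
  from span_not_UNIV_orthogonal[OF this] obtain w where "w \<noteq> 0" "\<forall>x\<in>span (range L). w \<bullet> x = 0"
    by auto
  then show ?thesis using that[of w] by (auto intro: span_base)
qed

lemma annihilates_H_deriv_jacobi_covector:
  fixes \<phi> w K :: "real ^ 'n::{finite,wellorder}"
  assumes ab: "a < b" and H: "H a b \<beta> K (\<phi>, l, t) = 0"
    and ann: "\<And>v. (w, s) \<bullet> H_deriv a b \<beta> K (\<phi>, l, t) v = 0"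
  shows "jacobi_covector (coupling TYPE('n) a b) (jacobi_diag a b \<beta> K (\<phi>, l, t)) (t * \<beta>) CARD('n)
     (seq \<phi>) (seq w) s"
proof -
  define c where "c = coupling TYPE('n) a b"
  \<comment> \<open>The transpose of the \<open>\<phi>\<close>-derivative applied to
    \<open>(w, s)\<close>; its blocks on the first component are symmetric. Testing with
    \<open>y = q\<close> yields \<open>q = 0\<close>.\<close>
  define q where "q = (1 - t) *\<^sub>R (diag K *v w) + D a b *v w + (3 * t * \<beta>) *\<^sub>R (\<chi> i. (\<phi> $ i)^2 * w $ i)
    - l *\<^sub>R w - s *\<^sub>R \<phi>"
  have "q \<bullet> y = (w, s) \<bullet> H_deriv a b \<beta> K (\<phi>, l, t) (y, 0, 0)" for y
  proof -
    have "(diag K *v w) \<bullet> y = w \<bullet> (diag K *v y)"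
      "(\<chi> i. (\<phi> $ i)^2 * w $ i) \<bullet> y = w \<bullet> (\<chi> i. (\<phi> $ i)^2 * y $ i)"
      by (simp_all add: inner_vec_def mult_ac)
    then show ?thesis
      unfolding q_def H_deriv_def
      by (simp add: inner_simps inner_prod_def D_symmetric)
  qed
  then have "q \<bullet> q = 0" using ann by simp
  then have "q = 0" by simp
  then have "q $ i = 0" for i by simp
  then have "\<forall>i::'n. (jacobi_diag a b \<beta> K (\<phi>, l, t) (pos i) + 2 * (t * \<beta>) * (seq \<phi> (pos i))^2) * seq w (pos i) =
      c * (seq w (pos i - 1) + seq w (Suc (pos i))) + s * seq \<phi> (pos i)"
    by (simp add: q_def jacobi_diag_def D_mult_nth c_def algebra_simps)
  then have "\<forall>k\<in>{1..CARD('n)}. (jacobi_diag a b \<beta> K (\<phi>, l, t) k + 2 * (t * \<beta>) * (seq \<phi> k)^2) * seq w k =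
      c * (seq w (k - 1) + seq w (Suc k)) + s * seq \<phi> k"
    unfolding ball_pos .
  moreover have "w \<bullet> \<phi> = 0"
    using ann[of "(0, 1, 0)"] by (simp add: H_deriv_def inner_simps inner_prod_def zero_vec_def[symmetric])
  ultimately show ?thesis
    by (simp add: jacobi_covector_def inner_seq c_def)
qed

text \<open>Otherwise \<open>jacobi_covector_eq_0\<close> gives \<open>w = 0\<close>, and the
  direction \<open>(\<phi>, 0, 0)\<close> then gives \<open>s = 0\<close>. The index found is one
  where the covector detects changes of \<open>K\<close>, since \<open>\<phi>\<close> does not
  vanish there.\<close>

lemma annihilating_covector_nonzero:
  fixes \<phi> w K :: "real ^ 'n::{finite,wellorder}"
  assumes ab: "a < b" and H: "H a b \<beta> K (\<phi>, l, t) = 0"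
    and ann: "\<And>v. (w, s) \<bullet> H_deriv a b \<beta> K (\<phi>, l, t) v = 0" and nz: "(w, s) \<noteq> 0"
  shows "\<exists>k\<in>{1..CARD('n)}. t * \<beta> * (seq \<phi> k)^2 * seq w k \<noteq> 0"
proof (rule ccontr)
  assume no: "\<not> ?thesis"
  note v = H_zero_jacobi_solution[OF ab H]
  note cv = annihilates_H_deriv_jacobi_covector[OF ab H ann]
  have "seq w k = 0" if "k \<le> CARD('n)" for k
    by (rule jacobi_covector_eq_0[OF coupling_pos[OF ab] _ v cv _ that]) (use no in auto)
  then have w: "w = 0" unfolding vec_eq_0_iff_seq by auto
  then have "s * (\<phi> \<bullet> \<phi>) = 0" using ann[of "(\<phi>, 0, 0)"] by (simp add: H_deriv_def inner_prod_def)
  moreover have "\<phi> \<bullet> \<phi> > 0" using H mesh_pos[OF ab, of "TYPE('n)"] by (simp add: H_eq_0_iff)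
  ultimately show False using w nz by (simp add: prod_eq_iff)
qed

section \<open>A parametrisation of the zero set by the potentials\<close>

text \<open>A zero \<open>(\<phi>, l, t)\<close> of \<open>H\<close> is encoded by \<open>x = (z, \<tau>)\<close> with \<open>\<tau> = t \<beta> \<phi>\<^sub>1\<^sup>2\<close>, \<open>z\<^sub>n = l\<close>, and the
  shifted potential \<open>z\<^sub>k = (1 - t) K\<^sub>k + d\<^sub>k - l\<close> for \<open>k < n\<close>.  The first \<open>n - 1\<close> equations give \<open>\<phi> / \<phi>\<^sub>1\<close>
  as a polynomial in \<open>x\<close>, the norm of \<open>\<phi>\<close> gives \<open>t\<close>, and the last equation gives \<open>K\<^sub>n\<close>.  Sard's
  theorem is applied to \<open>x \<mapsto> K\<close>.\<close>

definition shape :: "real \<Rightarrow> real \<Rightarrow> (real ^ 'n::{finite,wellorder}) \<times> real \<Rightarrow> nat \<Rightarrow> real" where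
  "shape a b x k = cubic_rec (1 / coupling TYPE('n::{finite,wellorder}) a b) (seq (fst x)) (snd x) k"

definition mass :: "real \<Rightarrow> real \<Rightarrow> (real ^ 'n::{finite,wellorder}) \<times> real \<Rightarrow> real" where
  "mass a b x = (\<Sum>k=1..CARD('n::{finite,wellorder}). (shape a b x k)^2)"

text \<open>From \<open>\<tau> = t \<beta> \<phi>\<^sub>1\<^sup>2\<close> and the normalisation
  \<open>\<phi>\<^sub>1\<^sup>2 = 1 / (h * mass)\<close>.\<close>

definition time_at :: "real \<Rightarrow> real \<Rightarrow> real \<Rightarrow> (real ^ 'n::{finite,wellorder}) \<times> real \<Rightarrow> real" where
  "time_at a b \<beta> x = snd x * (mesh TYPE('n::{finite,wellorder}) a b * mass a b x) / \<beta>"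

text \<open>\<open>\<sigma>\<close> restores the sign of the first entry, of which the parameters
  retain only the square.\<close>

definition zero_at :: "real \<Rightarrow> real \<Rightarrow> real \<Rightarrow> real \<Rightarrow> (real ^ 'n::{finite,wellorder}) \<times> real \<Rightarrow>
    'n::{finite,wellorder} point" where
  "zero_at a b \<beta> \<sigma> x =
    ((\<chi> i. \<sigma> * shape a b x (pos i) / sqrt (mesh TYPE('n::{finite,wellorder}) a b * mass a b x)),
     seq (fst x) CARD('n), time_at a b \<beta> x)"

text \<open>The last slot of \<open>z\<close> holds the eigenvalue, so the last potential is read
  off row \<open>n\<close>, \<open>g n * u n = c * u (n - 1)\<close>. The divisor is nonzero at
  zeros of \<open>H\<close> by \<open>jacobi_solution_last_nonzero\<close>.\<close>

definition potential_at ::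
    "real \<Rightarrow> real \<Rightarrow> real \<Rightarrow> (real ^ 'n::{finite,wellorder}) \<times> real \<Rightarrow> real ^ 'n::{finite,wellorder}" where
  "potential_at a b \<beta> x = (\<chi> i.
    ((if pos i = CARD('n)
      then coupling TYPE('n) a b * shape a b x (CARD('n) - 1) / shape a b x CARD('n)
        - snd x * (shape a b x CARD('n))^2
      else fst x $ i)
     + seq (fst x) CARD('n) - diagonal a b $ i) / (1 - time_at a b \<beta> x))"

lemma shape_1: "shape a b x (Suc 0) = 1" and shape_0: "shape a b x 0 = 0"
  by (simp_all add: shape_def)

lemma card_ge_1: "CARD('n::finite) \<ge> 1"
  by (simp add: Suc_le_eq)

lemma mass_pos: "mass a b (x :: (real ^ 'n::{finite,wellorder}) \<times> real) > 0"
proof -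
  have "(shape a b x 1)^2 \<le> mass a b x"
    unfolding mass_def using card_ge_1[where 'n = 'n] by (intro member_le_sum) auto
  then show ?thesis by (simp add: shape_1)
qed

lemma seq_zero_at:
  fixes x :: "(real ^ 'n::{finite,wellorder}) \<times> real"
  assumes "k \<le> CARD('n)"
  shows "seq (fst (zero_at a b \<beta> \<sigma> x)) k = \<sigma> * shape a b x k / sqrt (mesh TYPE('n) a b * mass a b x)"
proof (cases "k = 0")
  case False
  have "\<forall>k\<in>{1..CARD('n)}. seq (fst (zero_at a b \<beta> \<sigma> x)) k =
      \<sigma> * shape a b x k / sqrt (mesh TYPE('n) a b * mass a b x)"
    unfolding ball_pos by (simp add: zero_at_def)
  then show ?thesis using assms False by auto
qed (simp add: shape_0)

lemma H_zero_at:
  fixes x :: "(real ^ 'n::{finite,wellorder}) \<times> real"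
  assumes ab: "a < b" and b: "\<beta> \<noteq> 0" and \<sigma>: "\<sigma>^2 = 1"
    and last: "shape a b x CARD('n) \<noteq> 0" and t: "time_at a b \<beta> x \<noteq> 1"
  shows "H a b \<beta> (potential_at a b \<beta> x) (zero_at a b \<beta> \<sigma> x) = 0"
proof -
  define \<phi> where "\<phi> = fst (zero_at a b \<beta> \<sigma> x)"
  define h where "h = mesh TYPE('n) a b"
  define c where "c = coupling TYPE('n) a b"
  define r where "r = \<sigma> / sqrt (h * mass a b x)"
  have h: "h > 0" unfolding h_def by (rule mesh_pos[OF ab])
  have c: "c > 0" unfolding c_def by (rule coupling_pos[OF ab])
  have r2: "r^2 = 1 / (h * mass a b x)"
    using \<sigma> h mass_pos[of a b x] by (simp add: r_def power_divide)
  have \<phi>: "seq \<phi> k = r * shape a b x k" if "k \<le> CARD('n)" for k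
    using seq_zero_at[OF that, of a b \<beta> \<sigma> x] by (simp add: \<phi>_def r_def h_def)
  have p: "zero_at a b \<beta> \<sigma> x = (\<phi>, seq (fst x) CARD('n), time_at a b \<beta> x)"
    by (simp add: \<phi>_def zero_at_def)
  define K where "K = potential_at a b \<beta> x"
  \<comment> \<open>The Jacobi diagonal without its cubic term; at \<open>n\<close> it is the value
    forced by the last row.\<close>
  define e where "e k = (if k = CARD('n) then c * shape a b x (CARD('n) - 1) / shape a b x CARD('n)
        - snd x * (shape a b x CARD('n))^2 else seq (fst x) k)" for k
  have "\<forall>k\<in>{1..CARD('n)}. (1 - time_at a b \<beta> x) * seq K k = e k + seq (fst x) CARD('n)
      - seq (diagonal a b :: real ^ 'n::{finite,wellorder}) k"
    unfolding ball_pos using t by (simp add: K_def potential_at_def e_def c_def)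
  then have K: "(1 - time_at a b \<beta> x) * seq K k = e k + seq (fst x) CARD('n)
      - seq (diagonal a b :: real ^ 'n::{finite,wellorder}) k" if "k \<in> {1..CARD('n)}" for k
    using that by blast
  have cub: "time_at a b \<beta> x * \<beta> * (seq \<phi> k)^2 = snd x * (shape a b x k)^2" if "k \<le> CARD('n)" for k
    using b h mass_pos[of a b x]
    by (simp add: \<phi>[OF that] power_mult_distrib r2 time_at_def h_def[symmetric])
  have jd: "jacobi_diag a b \<beta> K (zero_at a b \<beta> \<sigma> x) k = e k + snd x * (shape a b x k)^2"
    if k: "k \<in> {1..CARD('n)}" for k
    unfolding p jacobi_diag_def using K[OF k] cub[of k] k by simp
  have "jacobi_diag a b \<beta> K (zero_at a b \<beta> \<sigma> x) k * seq \<phi> k = c * (seq \<phi> (k - 1) + seq \<phi> (Suc k))"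
    if k: "k \<in> {1..CARD('n)}" for k
  proof (cases "k = CARD('n)")
    case True
    have "e k + snd x * (shape a b x k)^2 = c * shape a b x (k - 1) / shape a b x k"
      by (simp add: e_def True)
    then show ?thesis using k last by (simp add: jd \<phi> True)
  next
    case False
    then obtain j where j: "k = Suc j" "Suc k \<le> CARD('n)" using k by (cases k) auto
    have "shape a b x (Suc k) = 1 / c * ((seq (fst x) k + snd x * (shape a b x k)^2) * shape a b x k)
        - shape a b x j"
      unfolding shape_def c_def j(1) cubic_rec.simps ..
    then have "(e k + snd x * (shape a b x k)^2) * shape a b x k
        = c * (shape a b x j + shape a b x (Suc k))"
      using c False by (simp add: e_def field_simps)
    moreover have "seq \<phi> k = r * shape a b x k" "seq \<phi> (k - 1) = r * shape a b x j"
      "seq \<phi> (Suc k) = r * shape a b x (Suc k)"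
      using j k by (auto simp: \<phi>)
    ultimately show ?thesis unfolding jd[OF k] by algebra
  qed
  moreover have "\<phi> \<bullet> \<phi> = 1 / h"
  proof -
    have "\<phi> \<bullet> \<phi> = (\<Sum>k=1..CARD('n). r^2 * (shape a b x k)^2)"
      unfolding inner_seq by (intro sum.cong) (auto simp: \<phi> power2_eq_square)
    also have "\<dots> = r^2 * mass a b x" by (simp add: mass_def sum_distrib_left)
    also have "\<dots> = 1 / h" using mass_pos[of a b x] by (simp add: r2)
    finally show ?thesis .
  qed
  ultimately show ?thesis
    unfolding p K_def[symmetric] H_eq_0_iff by (simp add: p h_def c_def)
qed

lemma shape_eq_poly:
  fixes x :: "(real ^ 'n::{finite,wellorder}) \<times> real"
  shows "shape a b x k = poly (cubic_rec [:1 / coupling TYPE('n) a b:] (\<lambda>k. [:seq (fst x) k:]) [:0, 1:] k) (snd x)"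
  by (simp add: shape_def poly_cubic_rec)

text \<open>Immediate because \<open>seq\<close> is defined as an inner product.\<close>

lemma polyfam_seq: "polyfam (\<lambda>z. [:seq z k:])"
  unfolding seq_def by (rule polyfam.coord)

lemma shape_differentiable: "(\<lambda>x. shape a b x k) differentiable (at x)"
  unfolding shape_eq_poly by (intro polyfam_differentiable polyfam_cubic_rec polyfam_seq)

lemma seq_fst_differentiable: "(\<lambda>x. seq (fst x) k) differentiable (at (x :: (real ^ 'n::{finite,wellorder}) \<times> real))"
  using polyfam_differentiable[OF polyfam_seq, of k] by simp

lemma mass_differentiable: "mass a b differentiable (at x)"
  unfolding mass_def[abs_def]
  by (auto intro!: differentiable_sum differentiable_power shape_differentiable)

lemma time_at_differentiable: "time_at a b \<beta> differentiable (at x)"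
proof -
  have "snd differentiable (at x)"
    by (rule bounded_linear_imp_differentiable[OF bounded_linear_snd])
  then have "(\<lambda>x. (snd x * (mesh TYPE('a) a b * mass a b x)) * (1 / \<beta>)) differentiable (at x)"
    by (intro differentiable_mult mass_differentiable differentiable_const)
  then show ?thesis by (simp add: time_at_def[abs_def])
qed

lemma differentiable_vec_componentwise:
  fixes f :: "'a::real_normed_vector \<Rightarrow> real ^ 'm"
  assumes "\<And>i. (\<lambda>x. f x $ i) differentiable (at a)"
  shows "f differentiable (at a)"
proof -
  obtain f' where "\<And>i. ((\<lambda>x. f x $ i) has_derivative f' i) (at a)"
    using assms unfolding differentiable_def by metis
  then have "(f has_derivative (\<lambda>y. \<chi> i. f' i y)) (at a)"
    by (intro has_derivative_vec_componentwise) simp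
  then show ?thesis unfolding differentiable_def by blast
qed

lemma potential_at_differentiable:
  fixes x :: "(real ^ 'n::{finite,wellorder}) \<times> real"
  assumes last: "shape a b x CARD('n) \<noteq> 0" and t: "time_at a b \<beta> x \<noteq> 1"
  shows "potential_at a b \<beta> differentiable (at x)"
proof (rule differentiable_vec_componentwise)
  fix i :: 'n
  have f: "(\<lambda>x :: (real ^ 'n::{finite,wellorder}) \<times> real. fst x $ i) differentiable (at x)"
    using seq_fst_differentiable[of "pos i" x] by simp
  have s: "snd differentiable (at x)"
    by (rule bounded_linear_imp_differentiable[OF bounded_linear_snd])
  show "(\<lambda>x. potential_at a b \<beta> x $ i) differentiable (at x)"
    unfolding potential_at_def using t last
    by (cases "pos i = CARD('n)")
      (auto intro!: differentiable_divide differentiable_diff differentiable_add differentiable_mult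
        differentiable_power differentiable_const f s
        shape_differentiable seq_fst_differentiable time_at_differentiable)
qed

lemma zero_at_differentiable:
  fixes x :: "(real ^ 'n::{finite,wellorder}) \<times> real"
  assumes ab: "a < b"
  shows "zero_at a b \<beta> \<sigma> differentiable (at x)"
proof -
  define h where "h = mesh TYPE('n) a b"
  have pos: "h * mass a b x > 0" unfolding h_def by (intro mult_pos_pos mesh_pos[OF ab] mass_pos)
  have "sqrt differentiable (at (h * mass a b x))"
    using DERIV_real_sqrt[OF pos] by (auto simp: real_differentiable_def)
  then have sq: "(\<lambda>x. sqrt (h * mass a b x)) differentiable (at x)"
    using differentiable_compose[of sqrt "\<lambda>x. h * mass a b x" x UNIV] mass_differentiable[of a b x]
    by (simp add: differentiable_mult)
  have 1: "(\<lambda>x. (\<chi> i::'n. \<sigma> * shape a b x (pos i) / sqrt (h * mass a b x))) differentiable (at x)"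
    by (rule differentiable_vec_componentwise)
      (use pos in \<open>auto intro!: differentiable_divide differentiable_mult shape_differentiable sq\<close>)
  obtain f1 f2 f3 where "((\<lambda>x. (\<chi> i::'n. \<sigma> * shape a b x (pos i) / sqrt (h * mass a b x))) has_derivative f1) (at x)"
    "((\<lambda>x::(real ^ 'n::{finite,wellorder}) \<times> real. seq (fst x) CARD('n)) has_derivative f2) (at x)"
    "(time_at a b \<beta> has_derivative f3) (at x)"
    using 1 seq_fst_differentiable[of "CARD('n)" x] time_at_differentiable[of a b \<beta> x]
    unfolding differentiable_def by blast
  then have "(zero_at a b \<beta> \<sigma> has_derivative (\<lambda>v. (f1 v, f2 v, f3 v))) (at x)"
    unfolding zero_at_def[abs_def] h_def[symmetric] by (intro has_derivative_Pair)
  then show ?thesis unfolding differentiable_def by blast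
qed

text \<open>The last two conclusions express the arguments of \<open>degeneracy\<close> in
  \<open>jacobi_covector_degeneracy_eq_0\<close> through \<open>x\<close>.\<close>

lemma zero_at_surj:
  fixes \<phi> K :: "real ^ 'n::{finite,wellorder}"
  assumes ab: "a < b" and b: "\<beta> \<noteq> 0" and H: "H a b \<beta> K (\<phi>, l, t) = 0" and t: "t \<noteq> 1"
  obtains x \<sigma> where "\<sigma>^2 = 1" "zero_at a b \<beta> \<sigma> x = (\<phi>, l, t)" "potential_at a b \<beta> x = K"
    "shape a b x CARD('n) \<noteq> 0" "snd x = t * \<beta> * (seq \<phi> 1)^2"
    "\<And>k. k \<in> {1..<CARD('n)} \<Longrightarrow>
       seq (fst x) k = jacobi_diag a b \<beta> K (\<phi>, l, t) k - t * \<beta> * (seq \<phi> k)^2"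
proof -
  define n where "n = CARD('n)"
  define h where "h = mesh TYPE('n) a b"
  define c where "c = coupling TYPE('n) a b"
  define v where "v = seq \<phi>"
  define g where "g = jacobi_diag a b \<beta> K (\<phi>, l, t)"
  have h: "h > 0" unfolding h_def by (rule mesh_pos[OF ab])
  have c: "c > 0" unfolding c_def by (rule coupling_pos[OF ab])
  have n: "n \<ge> 1" unfolding n_def by (rule card_ge_1)
  have jac: "jacobi_solution c g n v"
    unfolding c_def g_def n_def v_def by (rule H_zero_jacobi_solution[OF ab H])
  have v1: "v 1 \<noteq> 0" using jac by (simp add: jacobi_solution_def)
  define z :: "real ^ 'n::{finite,wellorder}" where "z = (\<chi> i. if pos i = n then l else g (pos i) - t * \<beta> * (v (pos i))^2)"
  define x where "x = (z, t * \<beta> * (v 1)^2)"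
  have "\<forall>k\<in>{1..CARD('n)}. seq z k = (if k = n then l else g k - t * \<beta> * (v k)^2)"
    unfolding ball_pos by (simp add: z_def)
  then have z: "seq z k = (if k = n then l else g k - t * \<beta> * (v k)^2)" if "k \<in> {1..n}" for k
    using that by (simp add: n_def)
  have u: "v k = v 1 * shape a b x k" if "k \<le> n" for k
    unfolding shape_def x_def fst_conv snd_conv c_def[symmetric]
    by (rule jacobi_solution_cubic_rec[OF _ jac _ that]) (use c z in auto)
  have sh: "shape a b x k = v k / v 1" if "k \<le> n" for k using u[OF that] v1 by simp
  have sndx: "snd x = t * \<beta> * (v 1)^2" by (simp add: x_def)
  have mass: "mass a b x = 1 / (h * (v 1)^2)"
  proof -
    have "mass a b x = (\<Sum>k=1..n. v k * v k) / (v 1)^2"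
      unfolding mass_def n_def[symmetric] sum_divide_distrib
      by (intro sum.cong) (auto simp: sh power_divide power2_eq_square)
    also have "(\<Sum>k=1..n. v k * v k) = 1 / h"
      using H by (simp add: H_eq_0_iff inner_seq v_def n_def h_def)
    finally show ?thesis by simp
  qed
  have time: "time_at a b \<beta> x = t"
    using h v1 b unfolding time_at_def mass h_def[symmetric] sndx by simp
  \<comment> \<open>The square root below is \<open>1 / \<bar>v 1\<bar>\<close>, so the sign of
    \<open>v 1\<close> has to be supplied.\<close>
  define \<sigma> where "\<sigma> = sgn (v 1)"
  have \<sigma>2: "\<sigma>^2 = 1" using v1 by (simp add: \<sigma>_def sgn_if)
  have sq: "sqrt (h * mass a b x) = 1 / \<bar>v 1\<bar>"
    using h by (simp add: mass real_sqrt_divide)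
  have "\<forall>k\<in>{1..CARD('n)}. \<sigma> * shape a b x k / sqrt (h * mass a b x) = v k"
    using v1 by (auto simp: sq sh n_def[symmetric] \<sigma>_def sgn_if)
  then have "(\<chi> i. \<sigma> * shape a b x (pos i) / sqrt (h * mass a b x)) = \<phi>"
    unfolding ball_pos by (simp add: v_def vec_eq_iff)
  moreover have xl: "seq (fst x) n = l" using z[of n] n by (simp add: x_def)
  ultimately have za: "zero_at a b \<beta> \<sigma> x = (\<phi>, l, t)"
    by (simp add: zero_at_def time h_def n_def)
  have last: "shape a b x n \<noteq> 0"
    using jacobi_solution_last_nonzero[OF c n jac] u[of n] by auto
  have gk: "g k = (1 - t) * seq K k + seq (diagonal a b :: real ^ 'n::{finite,wellorder}) k + t * \<beta> * (v k)^2 - l" for k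
    by (simp add: g_def jacobi_diag_def v_def)
  have "potential_at a b \<beta> x $ i = K $ i" for i
  proof (cases "pos i = n")
    case True
    have "g n * v n = c * v (n - 1)"
      using jac n by (auto simp: jacobi_solution_def dest!: bspec[where x = n])
    then have "c * shape a b x (n - 1) / shape a b x n = g n"
      using v1 last n by (simp add: sh divide_simps)
    moreover have "snd x * (shape a b x n)^2 = t * \<beta> * (v n)^2"
      using v1 by (simp add: sndx sh power_divide)
    ultimately have "potential_at a b \<beta> x $ i = (g n - t * \<beta> * (v n)^2 + l - diagonal a b $ i) / (1 - t)"
      using True xl by (simp add: potential_at_def time n_def c_def)
    also have "seq (diagonal a b :: real ^ 'n::{finite,wellorder}) n = diagonal a b $ i" "seq K n = K $ i"
      by (simp_all flip: True)
    ultimately show ?thesis using t gk[of n] by simp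
  next
    case False
    then have "fst x $ i = g (pos i) - t * \<beta> * (v (pos i))^2" by (simp add: x_def z_def)
    then have "potential_at a b \<beta> x $ i = (g (pos i) - t * \<beta> * (v (pos i))^2 + l - diagonal a b $ i) / (1 - t)"
      using False xl by (simp add: potential_at_def time n_def)
    then show ?thesis using t gk[of "pos i"] by simp
  qed
  then have pot: "potential_at a b \<beta> x = K" by (simp add: vec_eq_iff)
  show ?thesis
    by (rule that[OF \<sigma>2 za pot]) (use last z in \<open>auto simp: x_def v_def n_def g_def\<close>)
qed

section \<open>Regularity for almost all potentials\<close>

lemma H_change_potential:
  "H a b \<beta> K' (\<phi>, l, t) = H a b \<beta> K (\<phi>, l, t) + ((1 - t) *\<^sub>R (\<chi> i. (K' $ i - K $ i) * \<phi> $ i), 0)"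
  by (simp add: H_def prod_eq_iff vec_eq_iff algebra_simps)

text \<open>Differentiate \<open>H = 0\<close> along the parametrisation and pair with
  \<open>(w, s)\<close>: the motion of the zero drops out, and what remains confines the range of
  \<open>f'\<close> to the hyperplane orthogonal to the nonzero vector of products
  \<open>w $ i * \<phi> $ i\<close>.\<close>

lemma potential_at_not_submersion:
  fixes \<phi> w K :: "real ^ 'n::{finite,wellorder}"
  assumes ab: "a < b" and b: "\<beta> \<noteq> 0" and \<sigma>: "\<sigma>^2 = 1"
    and za: "zero_at a b \<beta> \<sigma> x = (\<phi>, l, t)" and pot: "potential_at a b \<beta> x = K"
    and last: "shape a b x CARD('n) \<noteq> 0" and t: "t \<noteq> 1"
    and ann: "\<And>v. (w, s) \<bullet> H_deriv a b \<beta> K (\<phi>, l, t) v = 0"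
    and nz: "\<phi> $ j * w $ j \<noteq> 0"
  shows "\<exists>f'. (potential_at a b \<beta> has_derivative f') (at x) \<and> \<not> surj f'"
proof -
  have time: "time_at a b \<beta> x = t" using za by (simp add: zero_at_def)
  obtain f' where f': "(potential_at a b \<beta> has_derivative f') (at x)"
    using potential_at_differentiable[OF last, of \<beta>] t time by (auto simp: differentiable_def)
  obtain Z where Z: "(zero_at a b \<beta> \<sigma> has_derivative Z) (at x)"
    using zero_at_differentiable[OF ab, of \<beta> \<sigma> x] by (auto simp: differentiable_def)
  obtain T where T: "(time_at a b \<beta> has_derivative T) (at x)"
    using time_at_differentiable[of a b \<beta> x] by (auto simp: differentiable_def)
  \<comment> \<open>Here \<open>H_zero_at\<close> applies, so \<open>q\<close> below vanishes on a
    neighbourhood of \<open>x\<close> and has derivative 0.\<close>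
  define U :: "((real ^ 'n::{finite,wellorder}) \<times> real) set"
    where "U = {y. shape a b y CARD('n) \<noteq> 0} \<inter> {y. time_at a b \<beta> y \<noteq> 1}"
  have "continuous_on UNIV (\<lambda>y :: (real ^ 'n::{finite,wellorder}) \<times> real. shape a b y CARD('n))"
    by (intro differentiable_imp_continuous_on) (simp add: differentiable_on_def shape_differentiable)
  moreover have "continuous_on UNIV (time_at a b \<beta> :: (real ^ 'n::{finite,wellorder}) \<times> real \<Rightarrow> real)"
    by (intro differentiable_imp_continuous_on) (simp add: differentiable_on_def time_at_differentiable)
  ultimately have "open U"
    unfolding U_def by (intro open_Int open_Collect_neq continuous_on_const)
  have "x \<in> U" using last t time by (simp add: U_def)
  \<comment> \<open>\<open>H\<close> is affine in \<open>K\<close>: passing from \<open>K\<close> to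
    the potential at \<open>y\<close> changes the paired value by \<open>(1 - t) * R y\<close>. The
    potential difference vanishes at \<open>x\<close>, so only its own derivative enters that of
    \<open>R\<close>.\<close>
  define R where "R y = (\<Sum>i\<in>UNIV. w $ i * fst (zero_at a b \<beta> \<sigma> y) $ i * (potential_at a b \<beta> y $ i - K $ i))" for y
  define q where "q y = (w, s) \<bullet> H a b \<beta> K (zero_at a b \<beta> \<sigma> y) + (1 - time_at a b \<beta> y) * R y" for y
  have q0: "q y = 0" if "y \<in> U" for y
  proof -
    obtain \<psi> m r where p: "zero_at a b \<beta> \<sigma> y = (\<psi>, m, r)" by (metis prod_cases3)
    have r: "r = time_at a b \<beta> y" using p by (simp add: zero_at_def)
    have "0 = (w, s) \<bullet> H a b \<beta> (potential_at a b \<beta> y) (zero_at a b \<beta> \<sigma> y)"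
      using H_zero_at[OF ab b \<sigma>, of y] that by (simp add: U_def)
    also have "\<dots> = (w, s) \<bullet> H a b \<beta> K (\<psi>, m, r) +
        (1 - r) * (w \<bullet> (\<chi> i. (potential_at a b \<beta> y $ i - K $ i) * \<psi> $ i))"
      unfolding p H_change_potential[of a b \<beta> "potential_at a b \<beta> y" \<psi> m r K]
      by (simp add: inner_add_right)
    also have "w \<bullet> (\<chi> i. (potential_at a b \<beta> y $ i - K $ i) * \<psi> $ i) = R y"
      by (simp add: R_def p inner_vec_def mult_ac)
    also have "(w, s) \<bullet> H a b \<beta> K (\<psi>, m, r) + (1 - r) * R y = q y"
      by (simp add: q_def p r)
    finally show ?thesis by simp
  qed
  have dR: "(R has_derivative (\<lambda>v. \<Sum>i\<in>UNIV. w $ i * \<phi> $ i * f' v $ i)) (at x)"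
    unfolding R_def
  proof (rule has_derivative_sum)
    fix i :: 'n
    have 1: "((\<lambda>y. fst (zero_at a b \<beta> \<sigma> y) $ i) has_derivative (\<lambda>v. fst (Z v) $ i)) (at x)"
      using bounded_linear.has_derivative[OF bounded_linear_vec_nth[of i] has_derivative_fst[OF Z]] .
    have 2: "((\<lambda>y. potential_at a b \<beta> y $ i) has_derivative (\<lambda>v. f' v $ i)) (at x)"
      using bounded_linear.has_derivative[OF bounded_linear_vec_nth[of i] f'] .
    show "((\<lambda>y. w $ i * fst (zero_at a b \<beta> \<sigma> y) $ i * (potential_at a b \<beta> y $ i - K $ i))
        has_derivative (\<lambda>v. w $ i * \<phi> $ i * f' v $ i)) (at x)"
      by (rule derivative_eq_intros 1 2 refl)+ (simp add: za pot)
  qed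
  have R0: "R x = 0" by (simp add: R_def pot)
  have "(H a b \<beta> K has_derivative H_deriv a b \<beta> K (\<phi>, l, t)) (at (zero_at a b \<beta> \<sigma> x))"
    unfolding za by (rule has_derivative_H)
  from has_derivative_compose[OF Z this]
  have dH: "((\<lambda>y. (w, s) \<bullet> H a b \<beta> K (zero_at a b \<beta> \<sigma> y)) has_derivative
      (\<lambda>v. (w, s) \<bullet> H_deriv a b \<beta> K (\<phi>, l, t) (Z v))) (at x)"
    by (rule has_derivative_inner_right)
  have "(q has_derivative (\<lambda>v. (1 - t) * (\<Sum>i\<in>UNIV. w $ i * \<phi> $ i * f' v $ i))) (at x)"
    unfolding q_def
    by (rule has_derivative_eq_rhs[OF has_derivative_add[OF dH
          has_derivative_mult[OF has_derivative_diff[OF has_derivative_const T] dR]]])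
      (simp add: R0 time ann)
  moreover have "(q has_derivative (\<lambda>_. 0)) (at x)"
  proof (rule has_derivative_transform_within_open)
    show "((\<lambda>_. 0) has_derivative (\<lambda>_. 0)) (at x)" by (rule has_derivative_const)
    show "0 = q y" if "y \<in> U" for y using q0[OF that] by simp
  qed fact+
  ultimately have "(\<lambda>v. (1 - t) * (\<Sum>i\<in>UNIV. w $ i * \<phi> $ i * f' v $ i)) = (\<lambda>_. 0)"
    by (rule has_derivative_unique)
  then have z: "(\<Sum>i\<in>UNIV. w $ i * \<phi> $ i * f' v $ i) = 0" for v
    using t by (auto dest: fun_cong[where x = v])
  have "\<not> surj f'"
  proof
    assume "surj f'"
    then obtain v where "(\<chi> i. w $ i * \<phi> $ i) = f' v" by (rule surjE)
    from this[symmetric] have "f' v $ i = w $ i * \<phi> $ i" for i by simp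
    then have "(\<Sum>i\<in>UNIV. (w $ i * \<phi> $ i)^2) = 0"
      using z[of v] by (simp add: power2_eq_square)
    then have "(w $ j * \<phi> $ j)^2 = 0" by (simp add: sum_nonneg_eq_0_iff)
    then show False using nz by simp
  qed
  then show ?thesis using f' by blast
qed

definition degeneracy_family :: "real \<Rightarrow> real \<Rightarrow> real ^ 'n::{finite,wellorder} \<Rightarrow> real poly" where
  "degeneracy_family a b z = degeneracy [:1 / coupling TYPE('n::{finite,wellorder}) a b:]
     (\<lambda>k. [:seq z k:]) [:0, 1:] CARD('n)"

lemma poly_degeneracy_family:
  "poly (degeneracy_family a b (z :: real ^ 'n::{finite,wellorder})) \<tau>
     = degeneracy (1 / coupling TYPE('n) a b) (seq z) \<tau> CARD('n)"
  by (simp add: degeneracy_family_def poly_degeneracy)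

lemma not_regular_value_subset:
  assumes ab: "a < b"
  shows "{K :: real ^ 'n::{finite,wellorder}. \<not> regular_value (H a b \<beta> K) H_dom 0} \<subseteq>
    potential_at a b \<beta> ` {x. poly (degeneracy_family a b (fst x)) (snd x) = 0 \<and>
      (\<exists>f'. (potential_at a b \<beta> has_derivative f') (at x) \<and> \<not> surj f')}"
proof
  fix K :: "real ^ 'n::{finite,wellorder}"
  assume "K \<in> {K. \<not> regular_value (H a b \<beta> K) H_dom 0}"
  then obtain p where p: "p \<in> H_dom" "H a b \<beta> K p = 0"
    and no: "\<not> (\<exists>f'. (H a b \<beta> K has_derivative f') (at p within H_dom) \<and> surj f')"
    by (auto simp: regular_value_def)
  obtain \<phi> l t where plt: "p = (\<phi>, l, t)" by (metis prod_cases3)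
  have t: "t \<noteq> 1" using p by (simp add: plt H_dom_def)
  have H: "H a b \<beta> K (\<phi>, l, t) = 0" using p plt by simp
  have der: "(H a b \<beta> K has_derivative H_deriv a b \<beta> K p) (at p)" by (rule has_derivative_H)
  then have "\<not> surj (H_deriv a b \<beta> K p)"
    using no has_derivative_at_withinI by blast
  then obtain ws where ws: "ws \<noteq> 0" "\<And>v. ws \<bullet> H_deriv a b \<beta> K p v = 0"
    using exists_annihilating_covector[OF has_derivative_linear[OF der]] by metis
  obtain w s where "ws = (w, s)" by (cases ws)
  with ws have ann: "\<And>v. (w, s) \<bullet> H_deriv a b \<beta> K (\<phi>, l, t) v = 0" and nz: "(w, s) \<noteq> 0"
    by (auto simp: plt)
  obtain k where k: "k \<in> {1..CARD('n)}" "t * \<beta> * (seq \<phi> k)^2 * seq w k \<noteq> 0"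
    using annihilating_covector_nonzero[OF ab H ann nz] by blast
  \<comment> \<open>A linear problem has no critical zeros; this justifies the division by
    \<open>\<beta>\<close> in \<open>time_at\<close>.\<close>
  then have b: "\<beta> \<noteq> 0" by auto
  have "\<exists>j. \<phi> $ j * w $ j \<noteq> 0"
  proof (rule ccontr)
    assume "\<not> ?thesis"
    then have "\<forall>k\<in>{1..CARD('n)}. seq \<phi> k * seq w k = 0" unfolding ball_pos by simp
    then show False using k by auto
  qed
  then obtain j where j: "\<phi> $ j * w $ j \<noteq> 0" by blast
  obtain x \<sigma> where x: "\<sigma>^2 = 1" "zero_at a b \<beta> \<sigma> x = (\<phi>, l, t)" "potential_at a b \<beta> x = K"
    "shape a b x CARD('n) \<noteq> 0" "snd x = t * \<beta> * (seq \<phi> 1)^2"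
    "\<And>k. k \<in> {1..<CARD('n)} \<Longrightarrow>
       seq (fst x) k = jacobi_diag a b \<beta> K (\<phi>, l, t) k - t * \<beta> * (seq \<phi> k)^2"
    using zero_at_surj[OF ab b H t] by blast
  have "degeneracy (1 / coupling TYPE('n) a b) (seq (fst x)) (t * \<beta> * (seq \<phi> 1)^2) CARD('n) = 0"
  proof (rule jacobi_covector_degeneracy_eq_0)
    show "coupling TYPE('n) a b \<noteq> 0" using coupling_pos[OF ab, of "TYPE('n)"] by simp
    show "\<exists>k\<le>CARD('n). seq w k \<noteq> 0" using k by auto
  qed (rule card_ge_1 H_zero_jacobi_solution[OF ab H]
      annihilates_H_deriv_jacobi_covector[OF ab H ann] x(6), assumption?)+
  then have "poly (degeneracy_family a b (fst x)) (snd x) = 0"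
    by (simp add: poly_degeneracy_family x(5))
  moreover have "\<exists>f'. (potential_at a b \<beta> has_derivative f') (at x) \<and> \<not> surj f'"
    by (rule potential_at_not_submersion[OF ab b x(1-4) t ann j])
  ultimately show "K \<in> potential_at a b \<beta> ` {x. poly (degeneracy_family a b (fst x)) (snd x) = 0 \<and>
      (\<exists>f'. (potential_at a b \<beta> has_derivative f') (at x) \<and> \<not> surj f')}"
    using x(3) by blast
qed

lemma AE_regular_value:
  assumes "a < b"
  shows "AE K :: real ^ 'n::{finite,wellorder} in lborel. regular_value (H a b \<beta> K) H_dom 0"
proof -
  define B :: "((real ^ 'n::{finite,wellorder}) \<times> real) set" where
    "B = {x. poly (degeneracy_family a b (fst x)) (snd x) = 0 \<and>
      (\<exists>f'. (potential_at a b \<beta> has_derivative f') (at x) \<and> \<not> surj f')}"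
  have pf: "polyfam (degeneracy_family a b :: real ^ 'n::{finite,wellorder} \<Rightarrow> real poly)"
    unfolding degeneracy_family_def[abs_def] by (intro polyfam_degeneracy polyfam_seq)
  \<comment> \<open>For each \<open>z\<close> separately, the value at \<open>\<tau> = 0\<close> is
    already nonzero.\<close>
  have nz: "degeneracy_family a b z \<noteq> 0" for z :: "real ^ 'n::{finite,wellorder}"
  proof
    assume "degeneracy_family a b z = 0"
    then have "poly (degeneracy_family a b z) 0 = 0" by simp
    then show False
      using degeneracy_0_neq_0[OF card_ge_1[where 'n = 'n], of "1 / coupling TYPE('n) a b" "seq z"]
      by (simp add: poly_degeneracy_family)
  qed
  have "negligible (potential_at a b \<beta> ` B)"
    by (rule polynomial_sard[OF pf]) (auto simp: B_def nz)
  moreover have "{K :: real ^ 'n::{finite,wellorder}. \<not> regular_value (H a b \<beta> K) H_dom 0} \<subseteq>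
      potential_at a b \<beta> ` B"
    unfolding B_def by (rule not_regular_value_subset[OF assms])
  ultimately have "negligible {K :: real ^ 'n::{finite,wellorder}. \<not> regular_value (H a b \<beta> K) H_dom 0}"
    by (rule negligible_subset)
  \<comment> \<open>Negligible sets are null for the completed measure; statements that hold almost
    everywhere transfer back to \<open>lborel\<close>.\<close>
  then have "AE K :: real ^ 'n::{finite,wellorder} in lebesgue. regular_value (H a b \<beta> K) H_dom 0"
    by (auto simp: negligible_iff_null_sets eventually_ae_filter)
  then show ?thesis by (simp add: AE_completion_iff)
qed

section \<open>Disjointness and boundedness of the homotopy paths\<close>

lemma H_zeros_isolated_zeros:
  assumes "a < b" "p \<in> H_zeros a b \<beta> (K :: real ^ 'n::{finite,wellorder})"
  shows "isolated_zeros CARD('n) (seq (fst p))" "seq (fst p) CARD('n) \<noteq> 0" "seq (fst p) 1 \<noteq> 0"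
proof -
  obtain \<phi> l t where p: "p = (\<phi>, l, t)" by (metis prod_cases3)
  have j: "jacobi_solution (coupling TYPE('n) a b) (jacobi_diag a b \<beta> K (\<phi>, l, t)) CARD('n) (seq \<phi>)"
    using assms by (intro H_zero_jacobi_solution) (auto simp: H_zeros_def p)
  show "isolated_zeros CARD('n) (seq (fst p))"
    using jacobi_solution_isolated_zeros[OF coupling_pos[OF assms(1)] j] by (simp add: p)
  show "seq (fst p) CARD('n) \<noteq> 0"
    using jacobi_solution_last_nonzero[OF coupling_pos[OF assms(1)] card_ge_1 j] by (simp add: p)
  show "seq (fst p) 1 \<noteq> 0" using j by (simp add: p jacobi_solution_def)
qed

lemma connected_H_zeros_sign_changes:
  fixes K :: "real ^ 'n::{finite,wellorder}"
  assumes ab: "a < b" and A: "connected A" "A \<subseteq> H_zeros a b \<beta> K" and "p \<in> A" "q \<in> A"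
  shows "sign_changes (seq (fst p)) CARD('n) = sign_changes (seq (fst q)) CARD('n)"
    and "seq (fst p) 1 > 0 \<longleftrightarrow> seq (fst q) 1 > 0"
proof -
  define f where "f r = (sign_changes (seq (fst r)) CARD('n), seq (fst r) 1 > 0)"
    for r :: "'n::{finite,wellorder} point"
  have "f p = f q"
  proof (rule connected_local_const[OF A(1) \<open>p \<in> A\<close> \<open>q \<in> A\<close>], intro ballI)
    fix r assume r: "r \<in> A"
    \<comment> \<open>Besides isolated zeros this supplies nonzero entries at \<open>n\<close>,
      where the sign count ends, and at 1.\<close>
    note iz = H_zeros_isolated_zeros[OF ab subsetD[OF A(2)]]
    have lim: "((\<lambda>x. seq (fst x) k) \<longlongrightarrow> seq (fst r) k) (at r within A)" for k
      unfolding seq_def by (intro tendsto_intros)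
    have ev: "\<forall>\<^sub>F x in at r within A. isolated_zeros CARD('n) (seq (fst x))"
      unfolding eventually_at_filter using iz(1) by (intro always_eventually) blast
    have "\<forall>\<^sub>F x in at r within A. sign_changes (seq (fst x)) CARD('n) = sign_changes (seq (fst r)) CARD('n)"
      using eventually_sign_changes_eq[where X = "\<lambda>x. seq (fst x)" and u = "seq (fst r)", OF lim ev iz(1)[OF r] le_refl card_ge_1 iz(2)[OF r]] .
    moreover have "\<forall>\<^sub>F x in at r within A. (seq (fst x) 1 > 0) = (seq (fst r) 1 > 0)"
      using eventually_eff_pos[where X = "\<lambda>x. seq (fst x)" and u = "seq (fst r)", OF lim iz(3)[OF r]]
      by eventually_elim simp
    ultimately show "\<forall>\<^sub>F x in at r within A. f r = f x"
      by eventually_elim (simp add: f_def)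
  qed
  then show "sign_changes (seq (fst p)) CARD('n) = sign_changes (seq (fst q)) CARD('n)"
    and "seq (fst p) 1 > 0 \<longleftrightarrow> seq (fst q) 1 > 0" by (simp_all add: f_def)
qed

text \<open>At \<open>t = 0\<close> the diagonal is independent of the eigenvector, so both points
  belong to one linear problem and Sturm comparison gives equal eigenvalues. The eigenvectors are
  then proportional, and norm and sign make the factor 1.\<close>

lemma initial_point_unique:
  fixes K :: "real ^ 'n::{finite,wellorder}"
  assumes ab: "a < b" and p: "p \<in> initial_points a b \<beta> K" and q: "q \<in> initial_points a b \<beta> K"
    and sc: "sign_changes (seq (fst p)) CARD('n) = sign_changes (seq (fst q)) CARD('n)"
    and s1: "seq (fst p) 1 > 0 \<longleftrightarrow> seq (fst q) 1 > 0"
  shows "p = q"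
proof -
  obtain \<phi> l where pl: "p = (\<phi>, l, 0)" and Hp: "H a b \<beta> K (\<phi>, l, 0) = 0"
    using p by (auto simp: initial_points_def)
  obtain \<psi> m where qm: "q = (\<psi>, m, 0)" and Hq: "H a b \<beta> K (\<psi>, m, 0) = 0"
    using q by (auto simp: initial_points_def)
  define c where "c = coupling TYPE('n) a b"
  define g where "g k = seq K k + seq (diagonal a b :: real ^ 'n::{finite,wellorder}) k" for k
  have c: "c > 0" unfolding c_def by (rule coupling_pos[OF ab])
  have u: "jacobi_solution c (\<lambda>k. g k - l) CARD('n) (seq \<phi>)"
    using H_zero_jacobi_solution[OF ab Hp] by (simp add: c_def g_def jacobi_diag_def)
  have w: "jacobi_solution c (\<lambda>k. g k - m) CARD('n) (seq \<psi>)"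
    using H_zero_jacobi_solution[OF ab Hq] by (simp add: c_def g_def jacobi_diag_def)
  have nz: "seq \<phi> 1 \<noteq> 0" "seq \<psi> 1 \<noteq> 0" using u w by (auto simp: jacobi_solution_def)
  then have s: "seq \<phi> 1 * seq \<psi> 1 > 0"
    using s1 by (auto simp: pl qm zero_less_mult_iff)
  have lm: "l = m"
    using jacobi_solution_eq_if_same_sign_changes[OF c card_ge_1 u w s] sc by (simp add: pl qm)
  define r where "r = seq \<phi> 1 / seq \<psi> 1"
  have r: "r > 0" using s by (auto simp: r_def zero_less_mult_iff zero_less_divide_iff)
  have "\<forall>k\<in>{1..CARD('n)}. seq \<phi> k = r * seq \<psi> k"
    using jacobi_solution_unique[OF c u w[folded lm]] nz by (auto simp: r_def divide_simps mult_ac)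
  then have \<phi>: "\<phi> = r *\<^sub>R \<psi>" unfolding ball_pos by (simp add: vec_eq_iff)
  have n: "\<phi> \<bullet> \<phi> = 1 / mesh TYPE('n) a b" "\<psi> \<bullet> \<psi> = 1 / mesh TYPE('n) a b"
    using Hp Hq by (simp_all add: H_eq_0_iff)
  have "r^2 * (\<psi> \<bullet> \<psi>) = \<psi> \<bullet> \<psi>"
    using n unfolding \<phi> by (simp add: power2_eq_square)
  moreover have "\<psi> \<bullet> \<psi> \<noteq> 0" using n mesh_pos[OF ab, of "TYPE('n)"] by simp
  ultimately have "r^2 = 1" by simp
  then have "r = 1" using r by (simp add: power2_eq_1_iff)
  then show ?thesis using lm \<phi> by (simp add: pl qm)
qed

text \<open>Two paths that meet form one connected set of zeros containing both initial points. This
  also covers a curve that returns to \<open>t = 0\<close>.\<close>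

lemma homotopy_paths_disjoint:
  assumes ab: "a < b"
    and p: "p \<in> initial_points a b \<beta> K" and q: "q \<in> initial_points a b \<beta> K" and "p \<noteq> q"
    and \<gamma>: "homotopy_path a b \<beta> K p S \<gamma>" and \<delta>: "homotopy_path a b \<beta> K q T \<delta>"
  shows "\<gamma> ` S \<inter> \<delta> ` T = {}"
proof (rule ccontr)
  assume meet: "\<gamma> ` S \<inter> \<delta> ` T \<noteq> {}"
  have "connected (\<gamma> ` S)" "connected (\<delta> ` T)"
    using \<gamma> \<delta> by (auto simp: homotopy_path_def is_interval_connected intro!: connected_continuous_image)
  then have con: "connected (\<gamma> ` S \<union> \<delta> ` T)" using meet by (rule connected_Un)
  have sub: "\<gamma> ` S \<union> \<delta> ` T \<subseteq> H_zeros a b \<beta> K" using \<gamma> \<delta> by (simp add: homotopy_path_def)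
  have "p \<in> \<gamma> ` S \<union> \<delta> ` T" "q \<in> \<gamma> ` S \<union> \<delta> ` T"
    using \<gamma> \<delta> by (auto simp: homotopy_path_def)
  from connected_H_zeros_sign_changes[OF ab con sub this] have "p = q"
    by (rule initial_point_unique[OF ab p q])
  then show False using \<open>p \<noteq> q\<close> by simp
qed

text \<open>Pairing the first equation with \<open>\<phi>\<close> gives \<open>l\<close> as a
  Rayleigh quotient, \<open>h * (\<phi> \<bullet> X)\<close>. A zero is thus a continuous function
  of \<open>(\<phi>, t)\<close>, which lies in a compact set once the time interval is closed at
  1.\<close>

lemma bounded_H_zeros:
  fixes K :: "real ^ 'n::{finite,wellorder}"
  assumes ab: "a < b"
  shows "bounded (H_zeros a b \<beta> K)"
proof -
  define h where "h = mesh TYPE('n) a b"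
  have h: "h > 0" unfolding h_def by (rule mesh_pos[OF ab])
  define X where "X x = (1 - snd x) *\<^sub>R (diag K *v fst x) + D a b *v fst x + (snd x * \<beta>) *\<^sub>R cube (fst x)"
    for x :: "(real ^ 'n::{finite,wellorder}) \<times> real"
  define P where "P x = (fst x, h * (fst x \<bullet> X x), snd x)" for x
  have "continuous_on UNIV (\<lambda>x :: (real ^ 'n::{finite,wellorder}) \<times> real. cube (fst x))"
    unfolding cube_def by (intro continuous_intros)
  moreover have "continuous_on UNIV (\<lambda>x :: (real ^ 'n::{finite,wellorder}) \<times> real. A *v fst x)"
    for A :: "real ^ 'n::{finite,wellorder} ^ 'n::{finite,wellorder}"
    by (intro linear_continuous_on bounded_linear_compose[OF matrix_vector_mul_bounded_linear bounded_linear_fst])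
  ultimately have "continuous_on UNIV P"
    unfolding P_def X_def by (intro continuous_intros)
  then have "compact (P ` (cball 0 (sqrt (1 / h)) \<times> {0..1}))"
    by (intro compact_continuous_image compact_Times compact_cball compact_Icc)
      (auto intro: continuous_on_subset)
  then have "bounded (P ` (cball 0 (sqrt (1 / h)) \<times> {0..1}))" by (rule compact_imp_bounded)
  moreover have "H_zeros a b \<beta> K \<subseteq> P ` (cball 0 (sqrt (1 / h)) \<times> {0..1})"
  proof
    fix p assume p: "p \<in> H_zeros a b \<beta> K"
    obtain \<phi> l t where plt: "p = (\<phi>, l, t)" by (metis prod_cases3)
    have H: "X (\<phi>, t) = l *\<^sub>R \<phi>" "\<phi> \<bullet> \<phi> = 1 / h" and t: "t \<in> {0..1}"
      using p by (auto simp: H_zeros_def H_dom_def plt H_def X_def h_def zero_prod_def)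
    have "P (\<phi>, t) = p" using h H by (simp add: P_def plt)
    moreover have "norm \<phi> = sqrt (1 / h)" using H(2) by (simp add: norm_eq_sqrt_inner)
    ultimately show "p \<in> P ` (cball 0 (sqrt (1 / h)) \<times> {0..1})"
      using t by (intro image_eqI[of _ _ "(\<phi>, t)"]) auto
  qed
  ultimately show ?thesis by (rule bounded_subset)
qed

theorem theorem3p2:
  fixes a b \<beta> :: real
  assumes "a < b"
  shows "AE K :: real ^ 'n::{finite,wellorder} in lborel.
     (regular_value (H a b \<beta> K) H_dom 0 \<and>
      (\<forall>p \<in> initial_points a b \<beta> K. \<forall>q \<in> initial_points a b \<beta> K. p \<noteq> q \<longrightarrow>
         (\<forall>S \<gamma> T \<delta>. homotopy_path a b \<beta> K p S \<gamma> \<longrightarrow> homotopy_path a b \<beta> K q T \<delta> \<longrightarrow>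
            \<gamma> ` S \<inter> \<delta> ` T = {}))) \<and>
     (\<forall>p \<in> initial_points a b \<beta> K. \<forall>S \<gamma>.
         homotopy_path a b \<beta> K p S \<gamma> \<longrightarrow> bounded (\<gamma> ` S))"
  using AE_regular_value[OF assms, of \<beta>]
proof (rule eventually_mono)
  fix K :: "real ^ 'n::{finite,wellorder}"
  assume reg: "regular_value (H a b \<beta> K) H_dom 0"
  have "bounded (\<gamma> ` S)" if "homotopy_path a b \<beta> K p S \<gamma>" for p S \<gamma>
    using that bounded_subset[OF bounded_H_zeros[OF assms]] by (auto simp: homotopy_path_def)
  then show "(regular_value (H a b \<beta> K) H_dom 0 \<and>
      (\<forall>p \<in> initial_points a b \<beta> K. \<forall>q \<in> initial_points a b \<beta> K. p \<noteq> q \<longrightarrow>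
         (\<forall>S \<gamma> T \<delta>. homotopy_path a b \<beta> K p S \<gamma> \<longrightarrow> homotopy_path a b \<beta> K q T \<delta> \<longrightarrow>
            \<gamma> ` S \<inter> \<delta> ` T = {}))) \<and>
     (\<forall>p \<in> initial_points a b \<beta> K. \<forall>S \<gamma>.
         homotopy_path a b \<beta> K p S \<gamma> \<longrightarrow> bounded (\<gamma> ` S))"
    using reg homotopy_paths_disjoint[OF assms] by blast
qed

end
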